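(* Let $\phi(z)=az+b$ where $a\in\mathbb{R}$, $0<|a|<1$ and $b\in\mathbb{C}$, and let $\sigma>0$. Then the composition operator $C_\phi$ is not cyclic on the Paley-Wiener space $B^2_\sigma$, whereas its adjoint $C_\phi^*$ is cyclic on $B^2_\sigma$. Hence $C_\phi$ is not complex symmetric.
   Context: For $\sigma>0$, the Paley-Wiener space $B^2_\sigma$ is the Hilbert space of all entire functions of exponential type $\leq\sigma$ whose restrictions to $\mathbb{R}$ belong to $L^2(\mathbb{R})$, with norm $\|f\|^2=\int_{-\infty}^{\infty}|f(t)|^2\,dt$ (and corresponding inner product). The composition operator is $C_\phi f=f\circ\phi$, which is bounded on $B^2_\sigma$ for the symbols considered. A bounded linear operator $T$ on a separable Hilbert space $\mathcal{H}$ is cyclic if there exists $f\in\mathcal{H}$ such that the linear span of $\{T^nf:n=0,1,2,\ldots\}$ is dense in $\mathcal{H}$. A conjugation on $\mathcal{H}$ is a conjugate-linear operator $J:\mathcal{H}\to\mathcal{H}$ such that $\langle Jf,Jg\rangle=\langle g,f\rangle$ for all $f,g\in\mathcal{H}$ and $J^2=I$; $T$ is complex symmetric if there is a conjugation $J$ on $\mathcal{H}$ with $JT=T^*J$. *)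

theory Defs
  imports "HOL-Complex_Analysis.Complex_Analysis" "HOL-Library.Function_Algebras"
begin

text \<open>The complex vector space of all functions \<open>complex \<Rightarrow> complex\<close>, with the pointwise operations.\<close>

definition scaleF :: "complex \<Rightarrow> (complex \<Rightarrow> complex) \<Rightarrow> complex \<Rightarrow> complex" where
  "scaleF c f = (\<lambda>z. c * f z)"

interpretation cfun: vector_space scaleF
  by unfold_locales (auto simp: scaleF_def fun_eq_iff algebra_simps)

text \<open>Exponential type \<open>\<le> \<sigma>\<close> means \<open>limsup (ln \<bar>f z\<bar> / \<bar>z\<bar>) \<le> \<sigma>\<close> as \<open>\<bar>z\<bar>\<close> tends to infinity,
  hence the loss of an arbitrarily small \<open>\<epsilon>\<close> in the exponent.\<close>

definition exp_type_le :: "real \<Rightarrow> (complex \<Rightarrow> complex) \<Rightarrow> bool" where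
  "exp_type_le \<sigma> f \<longleftrightarrow> (\<forall>\<epsilon>>0. \<exists>C. \<forall>z. cmod (f z) \<le> C * exp ((\<sigma> + \<epsilon>) * cmod z))"

text \<open>Measurability of the restriction to the real line is automatic for entire functions.
  Elements are functions rather than classes modulo null sets: an entire function is determined
  by its restriction to the real line.\<close>

definition paley_wiener :: "real \<Rightarrow> (complex \<Rightarrow> complex) set" where
  "paley_wiener \<sigma> = {f. f holomorphic_on UNIV \<and> exp_type_le \<sigma> f \<and>
     integrable lborel (\<lambda>t::real. (cmod (f (of_real t)))\<^sup>2)}"

definition pw_inner :: "(complex \<Rightarrow> complex) \<Rightarrow> (complex \<Rightarrow> complex) \<Rightarrow> complex" where
  "pw_inner f g = (LINT t|lborel. f (of_real (t::real)) * cnj (g (of_real t)))"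

definition pw_norm :: "(complex \<Rightarrow> complex) \<Rightarrow> real" where
  "pw_norm f = sqrt (LINT t|lborel. (cmod (f (of_real (t::real))))\<^sup>2)"

definition comp_op :: "(complex \<Rightarrow> complex) \<Rightarrow> (complex \<Rightarrow> complex) \<Rightarrow> complex \<Rightarrow> complex" where
  "comp_op \<phi> f = f \<circ> \<phi>"

text \<open>Operators are total functions of which only the values on \<open>paley_wiener \<sigma>\<close> matter.
  For bounded linear \<open>T\<close> the vector \<open>h\<close> below exists and is unique by the Riesz representation
  theorem. As the description is otherwise unspecified, a positive statement about
  \<open>pw_adjoint \<sigma> T\<close> requires the existence of the adjoint.\<close>

definition pw_adjoint ::
  "real \<Rightarrow> ((complex \<Rightarrow> complex) \<Rightarrow> complex \<Rightarrow> complex) \<Rightarrow> (complex \<Rightarrow> complex) \<Rightarrow> complex \<Rightarrow> complex" where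
  "pw_adjoint \<sigma> T g =
     (THE h. h \<in> paley_wiener \<sigma> \<and> (\<forall>f\<in>paley_wiener \<sigma>. pw_inner (T f) g = pw_inner f h))"

text \<open>Boundedness of \<open>T\<close> is deliberately not part of \<open>pw_cyclic\<close> and \<open>pw_complex_symmetric\<close>:
  their negations then say something about the operator beyond a failure of boundedness.\<close>

definition pw_cyclic :: "real \<Rightarrow> ((complex \<Rightarrow> complex) \<Rightarrow> complex \<Rightarrow> complex) \<Rightarrow> bool" where
  "pw_cyclic \<sigma> T \<longleftrightarrow> (\<exists>f\<in>paley_wiener \<sigma>. \<forall>g\<in>paley_wiener \<sigma>. \<forall>\<epsilon>>0.
     \<exists>h\<in>cfun.span (range (\<lambda>n. (T ^^ n) f)). pw_norm (g - h) < \<epsilon>)"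

definition pw_conjugation :: "real \<Rightarrow> ((complex \<Rightarrow> complex) \<Rightarrow> complex \<Rightarrow> complex) \<Rightarrow> bool" where
  "pw_conjugation \<sigma> J \<longleftrightarrow>
     J \<in> paley_wiener \<sigma> \<rightarrow> paley_wiener \<sigma> \<and>
     (\<forall>f\<in>paley_wiener \<sigma>. \<forall>g\<in>paley_wiener \<sigma>. J (f + g) = J f + J g) \<and>
     (\<forall>c. \<forall>f\<in>paley_wiener \<sigma>. J (scaleF c f) = scaleF (cnj c) (J f)) \<and>
     (\<forall>f\<in>paley_wiener \<sigma>. \<forall>g\<in>paley_wiener \<sigma>. pw_inner (J f) (J g) = pw_inner g f) \<and>
     (\<forall>f\<in>paley_wiener \<sigma>. J (J f) = f)"

definition pw_complex_symmetric :: "real \<Rightarrow> ((complex \<Rightarrow> complex) \<Rightarrow> complex \<Rightarrow> complex) \<Rightarrow> bool" where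
  "pw_complex_symmetric \<sigma> T \<longleftrightarrow>
     (\<exists>J. pw_conjugation \<sigma> J \<and> (\<forall>f\<in>paley_wiener \<sigma>. J (T f) = pw_adjoint \<sigma> T (J f)))"

end

theory Submission
  imports Defs "HOL-Probability.Sinc_Integral"
begin

text \<open>
  Write \<open>B \<sigma>\<close> for the Paley-Wiener space and \<open>T\<close> for composition with \<open>\<phi> z = a z + b\<close>.
  Everything rests on the reproducing kernel \<open>K w z = sin (\<sigma> (z - cnj w)) / (\<pi> (z - cnj w))\<close>, which lies
  in \<open>B \<sigma>\<close> and satisfies \<open>f w = \<langle>f, K w\<rangle>\<close>.

  \<^item> \<open>T\<close> is not cyclic. As \<open>\<bar>a\<bar> < 1\<close>, composition with \<open>\<phi>\<close> lowers the exponential type: \<open>T\<close> maps \<open>B \<sigma>\<close>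
    into \<open>B \<tau>\<close> with \<open>\<tau> = \<bar>a\<bar> \<sigma> < \<sigma>\<close>. The orthogonal complement of \<open>B \<tau>\<close> in \<open>B \<sigma>\<close> contains every difference
    of the kernels for \<open>\<sigma>\<close> and for \<open>\<tau>\<close> at a common point, because both reproduce the elements of \<open>B \<tau>\<close>.
    Two of these differences are independent, so one more orthogonality condition can be imposed:
    for each \<open>f\<close> some nonzero \<open>g\<close> is orthogonal to \<open>f\<close> and to all \<open>T\<^sup>n f\<close> with \<open>n \<ge> 1\<close>.

  \<^item> The adjoint is cyclic. It acts on kernels by \<open>K w \<mapsto> K (\<phi> w)\<close>. The orbit of a point \<open>w\<close> other than the
    fixed point \<open>p\<close> of \<open>\<phi>\<close> accumulates at \<open>p\<close>, so a function orthogonal to the orbit of \<open>K w\<close> vanishes on a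
    set with a limit point, hence identically. In a Hilbert space this makes the span dense.

  \<^item> A conjugation \<open>J\<close> with \<open>J T = T\<^sup>* J\<close> carries a cyclic vector of \<open>T\<^sup>*\<close> to a cyclic vector of \<open>T\<close>, so it
    cannot exist.

  Three analytic facts about \<open>B \<sigma>\<close>, usually read off from the Fourier transform, carry the argument. The
  reproducing formula (\<open>paley_wiener_reproducing\<close>) is obtained by contour integration. Invariance under
  complex translations (\<open>paley_wiener_shift\<close>, needed since \<open>b\<close> need not be real) and completeness
  (\<open>paley_wiener_complete\<close>) follow from such integral representations.
  The starting point is a growth estimate of the form \<open>\<bar>f z\<bar> \<le> C (1 + \<bar>z\<bar>) exp (\<kappa> \<bar>Im z\<bar>)\<close> for every \<open>\<kappa> > \<sigma>\<close> (\<open>paley_wiener_growth\<close>). It comes from the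
  Phragmen-Lindelof principle applied to an antiderivative of \<open>f\<close>: unlike \<open>f\<close> itself, the antiderivative is
  visibly controlled on the real line by the \<open>L\<^sup>2\<close> norm of \<open>f\<close>.
\<close>

section \<open>The cardinal sine as an entire function\<close>

definition csinc :: "complex \<Rightarrow> complex" where
  "csinc z = (if z = 0 then 1 else sin z / z)"

lemma holomorphic_csinc: "csinc holomorphic_on UNIV"
proof -
  have "(\<lambda>z::complex. if z = 0 then deriv sin 0 else (sin z - sin 0) / (z - 0)) holomorphic_on UNIV"
    by (rule pole_lemma_open) (auto intro: holomorphic_intros)
  moreover have "deriv sin (0::complex) = 1"
    using DERIV_imp_deriv[OF DERIV_sin[of "0::complex"]] by simp
  ultimately show ?thesis
    unfolding csinc_def by (simp add: if_distrib cong: if_cong)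
qed

lemma holomorphic_on_csinc [holomorphic_intros]:
  "f holomorphic_on S \<Longrightarrow> (\<lambda>z. csinc (f z)) holomorphic_on S"
  using holomorphic_on_compose[of f S csinc] holomorphic_on_subset[OF holomorphic_csinc]
  by (auto simp: o_def)

lemma continuous_on_csinc [continuous_intros]:
  "continuous_on S f \<Longrightarrow> continuous_on S (\<lambda>z. csinc (f z))"
  using continuous_on_compose2[OF holomorphic_on_imp_continuous_on[OF holomorphic_csinc]] by auto

lemma csinc_minus [simp]: "csinc (- z) = csinc z"
  by (simp add: csinc_def)

lemma cnj_csinc: "cnj (csinc z) = csinc (cnj z)"
  by (simp add: csinc_def cnj_sin)

lemma mult_csinc: "z * csinc z = sin z"
  by (simp add: csinc_def)

lemma cmod_sin_le: "cmod (sin z) \<le> exp \<bar>Im z\<bar>"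
proof -
  have "cmod (sin z) = cmod (exp (\<i> * z) - exp (- (\<i> * z))) / 2"
    by (simp add: sin_exp_eq norm_divide norm_mult)
  also have "\<dots> \<le> (cmod (exp (\<i> * z)) + cmod (exp (- (\<i> * z)))) / 2"
    by (intro divide_right_mono norm_triangle_ineq4) auto
  also have "\<dots> \<le> exp \<bar>Im z\<bar>"
  proof -
    have "exp (Im z) \<le> exp \<bar>Im z\<bar>" "exp (- Im z) \<le> exp \<bar>Im z\<bar>" by simp_all
    from add_mono[OF this] show ?thesis by (simp add: norm_exp_eq_Re add.commute del: exp_le_cancel_iff)
  qed
  finally show ?thesis .
qed

text \<open>The weight \<open>1 + \<bar>z\<bar>\<close> covers both regimes in one inequality: boundedness near the origin, and
  the decay of \<open>sin z / z\<close> at infinity.\<close>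

lemma csinc_bound:
  obtains C where "C > 0" "\<And>z. cmod (csinc z) * (1 + cmod z) \<le> C * exp \<bar>Im z\<bar>"
proof -
  have "compact (csinc ` cball 0 1)"
    by (intro compact_continuous_image holomorphic_on_imp_continuous_on
          holomorphic_on_subset[OF holomorphic_csinc]) auto
  then have "\<exists>D. \<forall>z\<in>cball 0 1. cmod (csinc z) \<le> D"
    using compact_imp_bounded[of "csinc ` cball 0 1"] unfolding bounded_iff by simp
  then obtain D where D: "\<And>z. cmod z \<le> 1 \<Longrightarrow> cmod (csinc z) \<le> D"
    by (auto simp: Ball_def)
  have D0: "D \<ge> 0" using order_trans[OF norm_ge_zero D[of 0]] by simp
  have "cmod (csinc z) * (1 + cmod z) \<le> (2 * D + 2) * exp \<bar>Im z\<bar>" for z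
  proof (cases "cmod z \<le> 1")
    case True
    have "cmod (csinc z) * (1 + cmod z) \<le> D * 2"
      using D[OF True] True D0 by (intro mult_mono) auto
    also have "\<dots> \<le> (2 * D + 2) * 1" by simp
    also have "\<dots> \<le> (2 * D + 2) * exp \<bar>Im z\<bar>"
      using D0 by (intro mult_left_mono) auto
    finally show ?thesis .
  next
    case False
    have "cmod (csinc z) * (1 + cmod z) \<le> cmod (csinc z) * (2 * cmod z)"
      using False by (intro mult_left_mono) auto
    also have "\<dots> = 2 * cmod (sin z)"
      by (subst mult_csinc[symmetric]) (simp add: norm_mult)
    also have "\<dots> \<le> 2 * exp \<bar>Im z\<bar>" using cmod_sin_le by simp
    also have "\<dots> \<le> (2 * D + 2) * exp \<bar>Im z\<bar>"
      using D0 by (intro mult_right_mono) auto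
    finally show ?thesis .
  qed
  with D0 show ?thesis by (intro that[of "2 * D + 2"]) auto
qed

section \<open>The Phragmen-Lindelof principle\<close>

text \<open>A quadrant has opening \<open>\<pi> / 2\<close>, for which the critical order of growth is 2, so order 1 is
  harmless. The substitution \<open>z = exp u\<close> turns the part of the quadrant outside the unit disc into a half
  strip. There \<open>exp (- u)\<close> cancels the linear growth allowed on the two rays, and the damping factor
  \<open>exp (- \<epsilon> z\<^bsup>3/2\<^esup>)\<close>, rotated to be centred on the diagonal, becomes single-valued and beats \<open>exp (B \<bar>z\<bar>)\<close>
  on the far edge of a long rectangle. The maximum principle and \<open>\<epsilon> \<rightarrow> 0\<close> give the bound.\<close>

lemma phragmen_lindelof_quadrant:
  assumes hol: "g holomorphic_on UNIV"
    and growth: "\<And>z. cmod (g z) \<le> A * exp (B * cmod z)" and "B \<ge> 0"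
    and real_ray: "\<And>x. x \<ge> 1 \<Longrightarrow> cmod (g (of_real x)) \<le> M * x"
    and imag_ray: "\<And>x. x \<ge> 1 \<Longrightarrow> cmod (g (\<i> * of_real x)) \<le> M * x"
  shows "\<exists>C. \<forall>z. 0 \<le> Re z \<longrightarrow> 0 \<le> Im z \<longrightarrow> cmod (g z) \<le> C * (1 + cmod z)"
proof -
  define M' where "M' = max M (A * exp B)"
  have A0: "A \<ge> 0" using order_trans[OF norm_ge_zero growth[of 0]] by simp
  have AM: "A \<le> M'"
  proof -
    have "A * 1 \<le> A * exp B" using A0 \<open>B \<ge> 0\<close> by (intro mult_left_mono) auto
    then show ?thesis by (simp add: M'_def)
  qed
  have M'0: "M' \<ge> 0" using A0 AM by simp
  define c where "c = cos (3 * pi / 8)"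
  have c0: "c > 0" unfolding c_def by (rule cos_gt_zero) (use pi_gt_zero in auto)
  \<comment> \<open>\<open>q\<close> is \<open>z\<^bsup>3/2\<^esup>\<close> after rotation by \<open>- \<pi> / 4\<close>: in the quadrant its argument stays within \<open>3 \<pi> / 8 < \<pi> / 2\<close>.\<close>
  define q where "q u = exp ((3/2) * (u - \<i> * of_real (pi / 4)))" for u :: complex
  have Req: "Re (q u) \<ge> c * exp (3/2 * Re u)" if "0 \<le> Im u" "Im u \<le> pi / 2" for u
  proof -
    have "Re (q u) = exp (3/2 * Re u) * cos (3/2 * (Im u - pi / 4))"
      by (simp add: q_def Re_exp)
    moreover have "cos (3 * pi / 8) \<le> cos \<bar>3/2 * (Im u - pi / 4)\<bar>"
    proof (rule cos_monotone_0_pi_le)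
      have "\<bar>Im u - pi / 4\<bar> \<le> pi / 4" using that by linarith
      then show "\<bar>3/2 * (Im u - pi / 4)\<bar> \<le> 3 * pi / 8" unfolding abs_mult by simp
    qed auto
    ultimately show ?thesis unfolding cos_abs_real c_def by (simp add: mult.commute)
  qed
  have key: "cmod (g (exp w) * exp (- w) * exp (- of_real \<epsilon> * q w)) \<le> M'"
    if w: "0 \<le> Re w" "0 \<le> Im w" "Im w \<le> pi / 2" and "\<epsilon> > 0" for w and \<epsilon> :: real
  proof -
    \<comment> \<open>Length of the rectangle: from this \<open>R\<close> on, the damping outweighs \<open>exp (B exp R)\<close>.\<close>
    define R where "R = max (Re w) (2 * ln (B / (\<epsilon> * c) + 1))"
    have R0: "R \<ge> 0" and wR: "Re w \<le> R" using w by (auto simp: R_def)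
    have "exp (R / 2) \<ge> exp (ln (B / (\<epsilon> * c) + 1))"
      unfolding R_def by (subst exp_le_cancel_iff) linarith
    moreover have "B / (\<epsilon> * c) + 1 > 0" using \<open>\<epsilon> > 0\<close> c0 \<open>B \<ge> 0\<close> by (intro add_nonneg_pos) auto
    ultimately have "exp (R / 2) \<ge> B / (\<epsilon> * c)" by simp
    then have "B \<le> \<epsilon> * c * exp (R / 2)" using \<open>\<epsilon> > 0\<close> c0 by (simp add: field_simps)
    then have "B * exp R \<le> \<epsilon> * c * exp (R / 2) * exp R" by (intro mult_right_mono) auto
    also have "exp (R / 2) * exp R = exp (3/2 * R)" by (simp flip: exp_add)
    then have "\<epsilon> * c * exp (R / 2) * exp R = \<epsilon> * (c * exp (3/2 * R))" by (simp add: mult.assoc)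
    finally have BR: "B * exp R \<le> \<epsilon> * (c * exp (3/2 * R))" .
    define S where "S = cbox 0 (Complex R (pi / 2))"
    have inS: "z \<in> S \<longleftrightarrow> 0 \<le> Re z \<and> Re z \<le> R \<and> 0 \<le> Im z \<and> Im z \<le> pi / 2" for z
      by (auto simp: S_def in_cbox_complex_iff)
    define p where "p u = g (exp u) * exp (- u) * exp (- of_real \<epsilon> * q u)" for u
    have holp: "p holomorphic_on UNIV"
      unfolding p_def q_def
      using holomorphic_on_compose[of exp UNIV g] holomorphic_on_subset[OF hol]
      by (auto intro!: holomorphic_intros simp: o_def)
    have bd: "cmod (p z) \<le> M'" if "z \<in> frontier S" for z
    proof -
      have zS: "z \<in> S" using that frontier_subset_closed[of S] by (auto simp: S_def)
      have "z \<notin> box 0 (Complex R (pi / 2))"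
        using that by (simp add: frontier_def S_def)
      then consider "Re z = 0" | "Re z = R" | "Im z = 0" | "Im z = pi / 2"
        using zS[unfolded inS] by (force simp: in_box_complex_iff)
      note edges = this
      have Rq: "\<epsilon> * (c * exp (3/2 * Re z)) \<le> \<epsilon> * Re (q z)"
        using Req[of z] zS[unfolded inS] \<open>\<epsilon> > 0\<close> by (intro mult_left_mono) auto
      have "0 \<le> \<epsilon> * (c * exp (3/2 * Re z))" using c0 \<open>\<epsilon> > 0\<close> by simp
      with Rq have q1: "cmod (exp (- of_real \<epsilon> * q z)) \<le> 1"
        by (simp add: norm_exp_eq_Re)
      show ?thesis using edges
      proof cases
        case 1
        have "cmod (p z) \<le> (A * exp B) * 1 * 1"
          unfolding p_def norm_mult
          by (intro mult_mono q1 order_trans[OF growth]) (use 1 A0 in \<open>auto simp: norm_exp_eq_Re\<close>)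
        then show ?thesis by (simp add: M'_def)
      next
        case 2
        have "cmod (p z) \<le> (A * exp (B * exp R)) * 1 * exp (- (\<epsilon> * (c * exp (3/2 * R))))"
          unfolding p_def norm_mult
          by (intro mult_mono order_trans[OF growth])
            (use 2 A0 R0 Rq in \<open>simp_all add: norm_exp_eq_Re\<close>)
        also have "\<dots> = A * exp (B * exp R - \<epsilon> * (c * exp (3/2 * R)))"
          unfolding mult_1_right mult.assoc exp_add[symmetric] by simp
        also have "\<dots> \<le> A * 1" using BR A0 by (intro mult_left_mono) auto
        finally show ?thesis using AM by simp
      next
        case 3
        have ez: "exp z = of_real (exp (Re z))" using 3 by (simp add: complex_eq_iff Re_exp Im_exp)
        have "cmod (p z) \<le> (M' * exp (Re z)) * exp (- Re z) * 1"
          unfolding p_def norm_mult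
        proof (intro mult_mono q1)
          have "cmod (g (exp z)) \<le> M * exp (Re z)"
            unfolding ez using zS[unfolded inS] by (intro real_ray) auto
          also have "\<dots> \<le> M' * exp (Re z)" by (intro mult_right_mono) (auto simp: M'_def)
          finally show "cmod (g (exp z)) \<le> M' * exp (Re z)" .
        qed (use M'0 in auto)
        also have "\<dots> = M'" by (simp add: exp_minus field_simps)
        finally show ?thesis .
      next
        case 4
        have ez: "exp z = \<i> * of_real (exp (Re z))" unfolding complex_eq_iff Re_exp Im_exp 4 by simp
        have "cmod (p z) \<le> (M' * exp (Re z)) * exp (- Re z) * 1"
          unfolding p_def norm_mult
        proof (intro mult_mono q1)
          have "cmod (g (exp z)) \<le> M * exp (Re z)"
            unfolding ez using zS[unfolded inS] by (intro imag_ray) auto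
          also have "\<dots> \<le> M' * exp (Re z)" by (intro mult_right_mono) (auto simp: M'_def)
          finally show "cmod (g (exp z)) \<le> M' * exp (Re z)" .
        qed (use M'0 in auto)
        also have "\<dots> = M'" by (simp add: exp_minus field_simps)
        finally show ?thesis .
      qed
    qed
    have "cmod (p w) \<le> M'"
    proof (rule maximum_modulus_frontier[of p S])
      show "p holomorphic_on interior S" using holp holomorphic_on_subset by blast
      show "continuous_on (closure S) p"
        using holomorphic_on_imp_continuous_on[OF holp] continuous_on_subset by blast
      show "bounded S" by (simp add: S_def)
      show "w \<in> S" using w wR by (simp add: inS)
    qed (rule bd)
    then show ?thesis by (simp add: p_def)
  qed
  have limit: "cmod (g (exp w)) \<le> M' * cmod (exp w)"
    if w: "0 \<le> Re w" "0 \<le> Im w" "Im w \<le> pi / 2" for w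
  proof -
    have "((\<lambda>\<epsilon>. cmod (g (exp w) * exp (- w) * exp (- of_real \<epsilon> * q w)))
            \<longlongrightarrow> cmod (g (exp w) * exp (- w) * exp (- of_real 0 * q w))) (at_right (0::real))"
      by (intro tendsto_intros)
    then have "cmod (g (exp w) * exp (- w) * exp (- of_real 0 * q w)) \<le> M'"
    proof (rule tendsto_upperbound)
      show "\<forall>\<^sub>F \<epsilon> in at_right 0. cmod (g (exp w) * exp (- w) * exp (- of_real \<epsilon> * q w)) \<le> M'"
        using eventually_at_right_less by (rule eventually_mono) (rule key[OF w])
    qed simp
    then show ?thesis
      by (simp add: norm_mult norm_divide norm_exp_eq_Re exp_minus field_simps)
  qed
  have "cmod (g z) \<le> (M' + A * exp B) * (1 + cmod z)" if z: "0 \<le> Re z" "0 \<le> Im z" for z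
  proof (cases "cmod z \<le> 1")
    case True
    have "B * cmod z \<le> B * 1" using True \<open>B \<ge> 0\<close> by (rule mult_left_mono)
    then have "A * exp (B * cmod z) \<le> A * exp (B * 1)" using A0 by (simp add: mult_left_mono)
    with growth[of z] have "cmod (g z) \<le> A * exp (B * 1)" by linarith
    also have "\<dots> \<le> (M' + A * exp B) * 1" using M'0 by simp
    also have "\<dots> \<le> (M' + A * exp B) * (1 + cmod z)" using M'0 A0 by (intro mult_left_mono) auto
    finally show ?thesis .
  next
    case False
    then have nz: "z \<noteq> 0" by auto
    have "cmod (g (exp (Ln z))) \<le> M' * cmod (exp (Ln z))"
    proof (rule limit)
      show "0 \<le> Re (Ln z)" using False nz by simp
      show "0 \<le> Im (Ln z)" using Im_Ln_pos_le[OF nz] z by simp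
      show "Im (Ln z) \<le> pi / 2" using Re_Ln_pos_le[OF nz] z by linarith
    qed
    then have "cmod (g z) \<le> M' * cmod z" unfolding exp_Ln[OF nz] .
    also have "\<dots> \<le> (M' + A * exp B) * (1 + cmod z)"
      by (intro mult_mono) (use M'0 A0 in simp_all)
    finally show ?thesis .
  qed
  then show ?thesis by blast
qed


text \<open>Multiplication by \<open>exp (\<i> \<kappa> z)\<close> leaves the modulus on the real line alone and makes the function
  bounded on the positive imaginary axis. The half plane is then two quadrants, the second of which is
  the first one rotated.\<close>

lemma phragmen_lindelof_half_plane:
  assumes hol: "g holomorphic_on UNIV"
    and growth: "\<And>z. cmod (g z) \<le> A * exp (\<kappa> * cmod z)" and "\<kappa> \<ge> 0"
    and real_line: "\<And>x. cmod (g (of_real x)) \<le> M * (1 + \<bar>x\<bar>)"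
  shows "\<exists>C. \<forall>z. 0 \<le> Im z \<longrightarrow> cmod (g z) \<le> C * ((1 + cmod z) * exp (\<kappa> * Im z))"
proof -
  define g1 where "g1 z = g z * exp (\<i> * of_real \<kappa> * z)" for z
  define g2 where "g2 z = g1 (\<i> * z)" for z
  have A0: "A \<ge> 0" using order_trans[OF norm_ge_zero growth[of 0]] by simp
  have M0: "M \<ge> 0" using order_trans[OF norm_ge_zero real_line[of 0]] by simp
  have norm_g1: "cmod (g1 z) = cmod (g z) * exp (- (\<kappa> * Im z))" for z
    by (simp add: g1_def norm_mult norm_exp_eq_Re)
  have hol1: "g1 holomorphic_on UNIV"
    unfolding g1_def using hol by (intro holomorphic_intros) auto
  have hol2: "g2 holomorphic_on UNIV"
    unfolding g2_def using holomorphic_on_compose[of "\<lambda>z. \<i> * z" UNIV g1] holomorphic_on_subset[OF hol1]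
    by (auto simp: o_def intro!: holomorphic_intros)
  have growth1: "cmod (g1 z) \<le> A * exp (2 * \<kappa> * cmod z)" for z
  proof -
    have "- (\<kappa> * Im z) \<le> \<kappa> * cmod z"
      using mult_left_mono[OF abs_Im_le_cmod[of z] \<open>\<kappa> \<ge> 0\<close>] abs_ge_minus_self[of "\<kappa> * Im z"] \<open>\<kappa> \<ge> 0\<close>
      by (simp add: abs_mult)
    then have "cmod (g1 z) \<le> (A * exp (\<kappa> * cmod z)) * exp (\<kappa> * cmod z)"
      unfolding norm_g1 using A0 by (intro mult_mono growth) auto
    also have "\<dots> = A * exp (2 * \<kappa> * cmod z)"
      by (simp add: mult.assoc flip: exp_add)
    finally show ?thesis .
  qed
  have real1: "cmod (g1 (of_real x)) \<le> (2 * M + A) * \<bar>x\<bar>" if "\<bar>x\<bar> \<ge> 1" for x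
  proof -
    have "cmod (g1 (of_real x)) \<le> M * (1 + \<bar>x\<bar>)" unfolding norm_g1 using real_line[of x] by simp
    also have "\<dots> \<le> M * (2 * \<bar>x\<bar>)" using that M0 by (intro mult_left_mono) auto
    also have "\<dots> \<le> (2 * M + A) * \<bar>x\<bar>" using A0 by (simp add: algebra_simps)
    finally show ?thesis .
  qed
  have imag1: "cmod (g1 (\<i> * of_real x)) \<le> (2 * M + A) * x" if "x \<ge> 1" for x
  proof -
    have "cmod (g1 (\<i> * of_real x)) \<le> (A * exp (\<kappa> * x)) * exp (- (\<kappa> * x))"
      unfolding norm_g1 using that growth[of "\<i> * of_real x"] by (simp add: norm_mult)
    also have "\<dots> = A * 1" unfolding mult.assoc exp_add[symmetric] by simp
    also have "\<dots> \<le> (2 * M + A) * x" using that A0 M0 by (intro mult_mono) auto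
    finally show ?thesis .
  qed
  have "\<exists>C. \<forall>z. 0 \<le> Re z \<longrightarrow> 0 \<le> Im z \<longrightarrow> cmod (g1 z) \<le> C * (1 + cmod z)"
  proof (rule phragmen_lindelof_quadrant[OF hol1 growth1])
    show "cmod (g1 (of_real x)) \<le> (2 * M + A) * x" if "x \<ge> 1" for x using real1[of x] that by simp
  qed (use imag1 \<open>\<kappa> \<ge> 0\<close> in auto)
  then obtain C1 where C1: "\<And>z. 0 \<le> Re z \<Longrightarrow> 0 \<le> Im z \<Longrightarrow> cmod (g1 z) \<le> C1 * (1 + cmod z)" by blast
  have "\<exists>C. \<forall>z. 0 \<le> Re z \<longrightarrow> 0 \<le> Im z \<longrightarrow> cmod (g2 z) \<le> C * (1 + cmod z)"
  proof (rule phragmen_lindelof_quadrant[OF hol2])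
    show "cmod (g2 z) \<le> A * exp (2 * \<kappa> * cmod z)" for z
      using growth1[of "\<i> * z"] by (simp add: g2_def norm_mult)
    show "cmod (g2 (of_real x)) \<le> (2 * M + A) * x" if "x \<ge> 1" for x
      using imag1[OF that] by (simp add: g2_def)
    show "cmod (g2 (\<i> * of_real x)) \<le> (2 * M + A) * x" if "x \<ge> 1" for x
      using real1[of "- x"] that by (simp add: g2_def flip: mult.assoc)
  qed (use \<open>\<kappa> \<ge> 0\<close> in auto)
  then obtain C2 where C2: "\<And>z. 0 \<le> Re z \<Longrightarrow> 0 \<le> Im z \<Longrightarrow> cmod (g2 z) \<le> C2 * (1 + cmod z)" by blast
  have "cmod (g z) \<le> max C1 C2 * ((1 + cmod z) * exp (\<kappa> * Im z))" if "0 \<le> Im z" for z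
  proof -
    have "cmod (g1 z) \<le> max C1 C2 * (1 + cmod z)"
    proof (cases "0 \<le> Re z")
      case True
      have "cmod (g1 z) \<le> C1 * (1 + cmod z)" using C1 True that by simp
      also have "\<dots> \<le> max C1 C2 * (1 + cmod z)" by (intro mult_right_mono) auto
      finally show ?thesis .
    next
      case False
      have "cmod (g1 z) = cmod (g2 (- (\<i> * z)))" by (simp add: g2_def flip: mult.assoc)
      also have "\<dots> \<le> C2 * (1 + cmod z)" using C2[of "- (\<i> * z)"] False that by (simp add: norm_mult)
      also have "\<dots> \<le> max C1 C2 * (1 + cmod z)" by (intro mult_right_mono) auto
      finally show ?thesis .
    qed
    then have "cmod (g1 z) * exp (\<kappa> * Im z) \<le> max C1 C2 * (1 + cmod z) * exp (\<kappa> * Im z)"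
      by (rule mult_right_mono) simp
    moreover have "cmod (g1 z) * exp (\<kappa> * Im z) = cmod (g z)"
      unfolding norm_g1 mult.assoc exp_add[symmetric] by simp
    ultimately show ?thesis by (simp add: mult.assoc)
  qed
  then show ?thesis by blast
qed

lemma phragmen_lindelof_plane:
  assumes hol: "g holomorphic_on UNIV"
    and growth: "\<And>z. cmod (g z) \<le> A * exp (\<kappa> * cmod z)" and "\<kappa> \<ge> 0"
    and real_line: "\<And>x. cmod (g (of_real x)) \<le> M * (1 + \<bar>x\<bar>)"
  shows "\<exists>C. \<forall>z. cmod (g z) \<le> C * ((1 + cmod z) * exp (\<kappa> * \<bar>Im z\<bar>))"
proof -
  obtain C1 where C1: "\<And>z. 0 \<le> Im z \<Longrightarrow> cmod (g z) \<le> C1 * ((1 + cmod z) * exp (\<kappa> * Im z))"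
    using phragmen_lindelof_half_plane[OF assms] by blast
  have "\<exists>C. \<forall>z. 0 \<le> Im z \<longrightarrow> cmod (g (- z)) \<le> C * ((1 + cmod z) * exp (\<kappa> * Im z))"
  proof (rule phragmen_lindelof_half_plane)
    show "(\<lambda>z. g (- z)) holomorphic_on UNIV"
      using holomorphic_on_compose[OF holomorphic_on_minus[OF holomorphic_on_ident] holomorphic_on_subset[OF hol]]
      by (simp add: o_def)
    show "cmod (g (- z)) \<le> A * exp (\<kappa> * cmod z)" for z using growth[of "- z"] by simp
    show "cmod (g (- of_real x)) \<le> M * (1 + \<bar>x\<bar>)" for x using real_line[of "- x"] by simp
  qed fact
  then obtain C2 where C2: "\<And>z. 0 \<le> Im z \<Longrightarrow> cmod (g (- z)) \<le> C2 * ((1 + cmod z) * exp (\<kappa> * Im z))"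
    by blast
  have "cmod (g z) \<le> max C1 C2 * ((1 + cmod z) * exp (\<kappa> * \<bar>Im z\<bar>))" for z
  proof (cases "0 \<le> Im z")
    case True
    have "cmod (g z) \<le> C1 * ((1 + cmod z) * exp (\<kappa> * \<bar>Im z\<bar>))" using C1[OF True] True by simp
    also have "\<dots> \<le> max C1 C2 * ((1 + cmod z) * exp (\<kappa> * \<bar>Im z\<bar>))" by (intro mult_right_mono) auto
    finally show ?thesis .
  next
    case False
    have "cmod (g z) \<le> C2 * ((1 + cmod z) * exp (\<kappa> * \<bar>Im z\<bar>))" using C2[of "- z"] False by simp
    also have "\<dots> \<le> max C1 C2 * ((1 + cmod z) * exp (\<kappa> * \<bar>Im z\<bar>))" by (intro mult_right_mono) auto
    finally show ?thesis .
  qed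
  then show ?thesis by blast
qed

section \<open>Growth of functions in the Paley-Wiener space\<close>

text \<open>The crude estimate \<open>\<bar>f\<bar> \<le> 1 + \<bar>f\<bar>\<^sup>2\<close> under the integral suffices: for Phragmen-Lindelof, linear growth
  on the real line is as good as the true order \<open>\<surd>x\<close>.\<close>

lemma norm_antiderivative_le:
  fixes f G :: "complex \<Rightarrow> complex"
  assumes deriv: "\<And>z. (G has_field_derivative f z) (at z)" and "G 0 = 0"
    and cont: "continuous_on UNIV f"
    and int: "integrable lborel (\<lambda>t::real. (cmod (f (of_real t)))\<^sup>2)" and "x \<ge> 0"
  shows "cmod (G (of_real x)) \<le> (1 + (LINT t|lborel. (cmod (f (of_real t)))\<^sup>2)) * (1 + x)"
proof -
  let ?N = "LINT t|lborel. (cmod (f (of_real t)))\<^sup>2"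
  have contr: "continuous_on S (\<lambda>t::real. f (of_real t))" for S
    by (rule continuous_on_compose2[OF cont]) (auto intro!: continuous_intros)
  have "((\<lambda>t. f (of_real t)) has_integral (G (of_real x) - G (of_real 0))) {0..x}"
    using \<open>x \<ge> 0\<close>
    by (intro fundamental_theorem_of_calculus has_vector_derivative_real_field)
      (auto intro: DERIV_subset[OF deriv])
  then have G: "((\<lambda>t. f (of_real t)) has_integral G (of_real x)) {0..x}"
    using \<open>G 0 = 0\<close> by simp
  have sq: "((\<lambda>t. (cmod (f (of_real t)))\<^sup>2) has_integral
      (LINT t:{0..x}|lborel. (cmod (f (of_real t)))\<^sup>2)) {0..x}"
  proof -
    have "set_integrable lborel {0..x} (\<lambda>t. (cmod (f (of_real t)))\<^sup>2)"
      unfolding set_integrable_def by (intro integrable_mult_indicator int) simp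
    from set_borel_integral_eq_integral[OF this] show ?thesis by (simp add: integrable_integral)
  qed
  have le: "(LINT t:{0..x}|lborel. (cmod (f (of_real t)))\<^sup>2) \<le> ?N"
    unfolding set_lebesgue_integral_def
    by (intro integral_mono int integrable_mult_indicator) (auto split: split_indicator)
  have one: "((\<lambda>t::real. 1::real) has_integral x) {0..x}"
    using has_integral_const_real[of "1::real" 0 x] \<open>x \<ge> 0\<close> by simp
  have "cmod (integral {0..x} (\<lambda>t. f (of_real t)))
      \<le> integral {0..x} (\<lambda>t. 1 + (cmod (f (of_real t)))\<^sup>2)"
  proof (rule integral_norm_bound_integral)
    show "(\<lambda>t. f (of_real t)) integrable_on {0..x}" using G by blast
    show "(\<lambda>t. 1 + (cmod (f (of_real t)))\<^sup>2) integrable_on {0..x}" using has_integral_add[OF one sq] by blast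
    show "cmod (f (of_real t)) \<le> 1 + (cmod (f (of_real t)))\<^sup>2" for t
      using zero_le_power2[of "cmod (f (of_real t)) - 1"] zero_le_power2[of "cmod (f (of_real t))"]
      unfolding power2_diff power_one mult_1_right by linarith
  qed
  also have "integral {0..x} (\<lambda>t. 1 + (cmod (f (of_real t)))\<^sup>2) = x + (LINT t:{0..x}|lborel. (cmod (f (of_real t)))\<^sup>2)"
    by (rule integral_unique) (rule has_integral_add[OF one sq])
  also have "\<dots> \<le> x + ?N" using le by simp
  also have "\<dots> \<le> (1 + ?N) * (1 + x)"
    using \<open>x \<ge> 0\<close> by (simp add: algebra_simps integral_nonneg_AE)
  finally show ?thesis using integral_unique[OF G] by simp
qed

lemma paley_wienerD:
  assumes "f \<in> paley_wiener \<sigma>"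
  shows "f holomorphic_on UNIV" "continuous_on UNIV f" "exp_type_le \<sigma> f"
    "integrable lborel (\<lambda>t::real. (cmod (f (of_real t)))\<^sup>2)"
  using assms by (auto simp: paley_wiener_def holomorphic_on_imp_continuous_on)

text \<open>The antiderivative \<open>G\<close> of \<open>f\<close> has the same exponential type and grows at most linearly on the real
  line, so \<open>phragmen_lindelof_plane\<close> applies to it. Cauchy's inequality on unit circles passes the bound
  on to \<open>f = G'\<close>.\<close>

lemma paley_wiener_growth:
  assumes f: "f \<in> paley_wiener \<sigma>" and "\<sigma> \<ge> 0" "\<kappa> > \<sigma>"
  obtains C where "\<And>z. cmod (f z) \<le> C * ((1 + cmod z) * exp (\<kappa> * \<bar>Im z\<bar>))"
proof -
  note fD = paley_wienerD[OF f]
  obtain G0 where G0: "\<And>z. (G0 has_field_derivative f z) (at z)"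
    using holomorphic_convex_primitive'[OF convex_UNIV open_UNIV fD(1)] by auto
  define G where "G z = G0 z - G0 0" for z
  have G: "(G has_field_derivative f z) (at z within S)" for z S
    unfolding G_def using DERIV_subset[OF G0] by (auto intro!: derivative_eq_intros)
  have "G 0 = 0" by (simp add: G_def)
  \<comment> \<open>Half of the gap absorbs the \<open>\<epsilon>\<close> in the exponential type, half the factor \<open>\<bar>z\<bar>\<close> from integrating.\<close>
  define \<epsilon> where "\<epsilon> = (\<kappa> - \<sigma>) / 2"
  have "\<epsilon> > 0" using assms by (simp add: \<epsilon>_def)
  obtain D where D: "\<And>z. cmod (f z) \<le> D * exp ((\<sigma> + \<epsilon>) * cmod z)"
    using fD(3) \<open>\<epsilon> > 0\<close> unfolding exp_type_le_def by blast
  have D0: "D \<ge> 0" using order_trans[OF norm_ge_zero D[of 0]] by simp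
  have growthG: "cmod (G z) \<le> D / \<epsilon> * exp (\<kappa> * cmod z)" for z
  proof -
    have "cmod (G z - G 0) \<le> (D * exp ((\<sigma> + \<epsilon>) * cmod z)) * cmod (z - 0)"
    proof (rule field_differentiable_bound[where S = "cball 0 (cmod z)" and f' = f])
      fix w :: complex assume "w \<in> cball 0 (cmod z)"
      then have "(\<sigma> + \<epsilon>) * cmod w \<le> (\<sigma> + \<epsilon>) * cmod z"
        using \<open>\<epsilon> > 0\<close> \<open>\<sigma> \<ge> 0\<close> by (intro mult_left_mono) auto
      then show "cmod (f w) \<le> D * exp ((\<sigma> + \<epsilon>) * cmod z)"
        using D0 by (intro order_trans[OF D] mult_left_mono) auto
    qed (auto intro: G)
    also have "\<dots> \<le> (D * exp ((\<sigma> + \<epsilon>) * cmod z)) * (exp (\<epsilon> * cmod z) / \<epsilon>)"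
    proof (rule mult_left_mono)
      have "\<epsilon> * cmod z \<le> exp (\<epsilon> * cmod z)" using exp_ge_add_one_self[of "\<epsilon> * cmod z"] by linarith
      then show "cmod (z - 0) \<le> exp (\<epsilon> * cmod z) / \<epsilon>" using \<open>\<epsilon> > 0\<close> by (simp add: field_simps)
    qed (use D0 in auto)
    also have "\<dots> = D / \<epsilon> * (exp ((\<sigma> + \<epsilon>) * cmod z) * exp (\<epsilon> * cmod z))" by simp
    also have "exp ((\<sigma> + \<epsilon>) * cmod z) * exp (\<epsilon> * cmod z) = exp (\<kappa> * cmod z)"
      unfolding exp_add[symmetric] \<epsilon>_def by (simp add: field_simps)
    finally show ?thesis using \<open>G 0 = 0\<close> by simp
  qed
  define N where "N = (LINT t|lborel. (cmod (f (of_real t)))\<^sup>2)"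
  have realG: "cmod (G (of_real x)) \<le> (1 + N) * (1 + \<bar>x\<bar>)" for x
  proof (cases "x \<ge> 0")
    case True
    then show ?thesis
      using norm_antiderivative_le[OF G[of _ UNIV] \<open>G 0 = 0\<close> fD(2,4) True] by (simp add: N_def)
  next
    case False
    let ?f = "\<lambda>z. - f (- z)" and ?G = "\<lambda>z. G (- z)"
    have "cmod (?G (of_real (- x))) \<le> (1 + (LINT t|lborel. (cmod (?f (of_real t)))\<^sup>2)) * (1 + (- x))"
    proof (rule norm_antiderivative_le)
      show "(?G has_field_derivative ?f z) (at z)" for z
        using DERIV_chain'[OF DERIV_minus[OF DERIV_ident] G[of "- z" UNIV]] by simp
      show "continuous_on UNIV ?f"
        by (intro continuous_intros continuous_on_compose2[OF fD(2)]) auto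
      show "integrable lborel (\<lambda>t::real. (cmod (?f (of_real t)))\<^sup>2)"
        using lborel_integrable_real_affine[OF fD(4), of "-1" 0] by simp
    qed (use False \<open>G 0 = 0\<close> in auto)
    also have "(LINT t|lborel. (cmod (?f (of_real t)))\<^sup>2) = N"
      unfolding N_def using lborel_integral_real_affine[of "-1" "\<lambda>t. (cmod (f (of_real t)))\<^sup>2" 0] by simp
    finally show ?thesis using False by simp
  qed
  have "G holomorphic_on UNIV" using G by (auto simp: holomorphic_on_def field_differentiable_def)
  from phragmen_lindelof_plane[OF this growthG _ realG] assms
  obtain C where C: "\<And>z. cmod (G z) \<le> C * ((1 + cmod z) * exp (\<kappa> * \<bar>Im z\<bar>))" by (meson less_imp_le order_trans)
  have C0: "C \<ge> 0" using order_trans[OF norm_ge_zero C[of 0]] by simp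
  have "cmod (f z) \<le> (2 * C * exp \<kappa>) * ((1 + cmod z) * exp (\<kappa> * \<bar>Im z\<bar>))" for z
  proof -
    have "cmod ((deriv ^^ 1) G z) \<le> fact 1 * (C * ((2 + cmod z) * exp (\<kappa> * (\<bar>Im z\<bar> + 1)))) / 1 ^ 1"
    proof (rule Cauchy_inequality)
      fix w assume "cmod (z - w) = 1"
      then have 1: "cmod w \<le> cmod z + 1" and 2: "\<bar>Im w\<bar> \<le> \<bar>Im z\<bar> + 1"
        using norm_triangle_ineq2[of w z] abs_Im_le_cmod[of "z - w"] by (auto simp: norm_minus_commute)
      have "\<kappa> * \<bar>Im w\<bar> \<le> \<kappa> * (\<bar>Im z\<bar> + 1)" using 2 assms by (intro mult_left_mono) auto
      then show "cmod (G w) \<le> C * ((2 + cmod z) * exp (\<kappa> * (\<bar>Im z\<bar> + 1)))"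
        using 1 C0 by (intro order_trans[OF C] mult_left_mono mult_mono) auto
    qed (auto intro: holomorphic_on_subset[OF \<open>G holomorphic_on UNIV\<close>]
          continuous_on_subset[OF holomorphic_on_imp_continuous_on[OF \<open>G holomorphic_on UNIV\<close>]])
    moreover have "deriv G z = f z" using G by (rule DERIV_imp_deriv)
    ultimately have "cmod (f z) \<le> C * ((2 + cmod z) * exp (\<kappa> * (\<bar>Im z\<bar> + 1)))" by simp
    also have "exp (\<kappa> * (\<bar>Im z\<bar> + 1)) = exp \<kappa> * exp (\<kappa> * \<bar>Im z\<bar>)"
      unfolding exp_add[symmetric] by (simp add: algebra_simps)
    also have "C * ((2 + cmod z) * (exp \<kappa> * exp (\<kappa> * \<bar>Im z\<bar>)))
        \<le> C * ((2 + 2 * cmod z) * (exp \<kappa> * exp (\<kappa> * \<bar>Im z\<bar>)))"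
      using C0 by (intro mult_left_mono mult_right_mono) auto
    also have "\<dots> = (2 * C * exp \<kappa>) * ((1 + cmod z) * exp (\<kappa> * \<bar>Im z\<bar>))" by (simp add: algebra_simps)
    finally show ?thesis .
  qed
  then show ?thesis by (rule that)
qed

section \<open>The reproducing formula\<close>

lemma integral_part_circlepath_split:
  assumes "continuous_on UNIV (\<lambda>t. f (c + of_real r * cis t))"
  shows "contour_integral (part_circlepath c r 0 pi) f + contour_integral (part_circlepath c r pi (2 * pi)) f
    = contour_integral (circlepath c r) f"
proof -
  let ?g = "\<lambda>t. f (c + of_real r * cis t) * of_real r * \<i> * cis t"
  have "continuous_on {0..2*pi} ?g"
    by (intro continuous_intros continuous_on_subset[OF assms]) auto
  then have "?g integrable_on {0..2*pi}" by (rule integrable_continuous_real)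
  then have "integral {0..pi} ?g + integral {pi..2*pi} ?g = integral {0..2*pi} ?g"
    by (intro Henstock_Kurzweil_Integration.integral_combine) (use pi_gt_zero in auto)
  then show ?thesis
    by (simp add: circlepath_def contour_integral_part_circlepath_eq pi_gt_zero)
qed

lemma integral_entire_eq_primitive:
  fixes a b :: real and f P :: "complex \<Rightarrow> complex"
  assumes "\<And>z. (P has_field_derivative f z) (at z)" "a \<le> b"
  shows "integral {a..b} (\<lambda>t. f (of_real t)) = P (of_real b) - P (of_real a)"
  using assms
  by (intro integral_unique fundamental_theorem_of_calculus has_vector_derivative_real_field)
    (auto intro: DERIV_subset)

text \<open>The sign \<open>s = \<plusminus>1\<close> selects the upper or the lower semicircle. On it the exponential factor undoes the
  growth \<open>exp (\<kappa> \<bar>Im z\<bar>)\<close> of \<open>F\<close>, so the integrand is \<open>O(1 / R\<^sup>2)\<close> while the arc has length \<open>\<pi> R\<close>.\<close>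

lemma semicircle_bound:
  fixes F :: "complex \<Rightarrow> complex"
  assumes hol: "F holomorphic_on UNIV"
    and bound: "\<And>z. cmod (F z) * (1 + cmod z) \<le> D * exp (\<kappa> * \<bar>Im z\<bar>)"
    and R: "R > cmod w"
    and arc: "\<And>z. z \<in> path_image (part_circlepath 0 R a b) \<Longrightarrow> s * Im z = \<bar>Im z\<bar>"
    and "b - a = pi"
  shows "cmod (contour_integral (part_circlepath 0 R a b) (\<lambda>z. F z * exp (\<i> * of_real (s * \<kappa>) * (z - w)) / (z - w)))
    \<le> D * exp (s * \<kappa> * Im w) * pi / (R - cmod w)"
proof -
  have R0: "R > 0" using R norm_ge_zero[of w] by linarith
  have D0: "D \<ge> 0" using order_trans[OF _ bound[of 0]] by simp
  let ?f = "\<lambda>z. F z * exp (\<i> * of_real (s * \<kappa>) * (z - w)) / (z - w)"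
  have norm_arc: "cmod z = R" if "z \<in> path_image (part_circlepath 0 R a b)" for z
    using in_path_image_part_circlepath[OF that] R0 \<open>b - a = pi\<close> pi_gt_zero by simp
  have "cmod (contour_integral (part_circlepath 0 R a b) ?f)
      \<le> (D * exp (s * \<kappa> * Im w) / (1 + R) / (R - cmod w)) * R * \<bar>b - a\<bar>"
  proof (rule contour_integral_bound_part_circlepath)
    have "continuous_on (path_image (part_circlepath 0 R a b)) ?f"
      by (intro continuous_intros continuous_on_subset[OF holomorphic_on_imp_continuous_on[OF hol]])
        (use norm_arc R in auto)
    then show "?f contour_integrable_on part_circlepath 0 R a b"
      by (rule contour_integrable_continuous_part_circlepath)
    fix z assume z: "z \<in> path_image (part_circlepath 0 R a b)"
    have "R - cmod w \<le> cmod (z - w)" using norm_arc[OF z] norm_triangle_ineq2[of z w] by simp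
    moreover have "cmod (F z * exp (\<i> * of_real (s * \<kappa>) * (z - w))) \<le> D * exp (s * \<kappa> * Im w) / (1 + R)"
    proof -
      have "cmod (F z) * (1 + R) * exp (- (s * \<kappa> * Im (z - w)))
          \<le> (D * exp (\<kappa> * \<bar>Im z\<bar>)) * exp (- (s * \<kappa> * Im (z - w)))"
        using bound[of z] norm_arc[OF z] by (intro mult_right_mono) auto
      also have "\<dots> = D * exp (\<kappa> * \<bar>Im z\<bar> - s * \<kappa> * Im (z - w))"
        unfolding mult.assoc exp_add[symmetric] by simp
      also have "\<kappa> * \<bar>Im z\<bar> - s * \<kappa> * Im (z - w) = s * \<kappa> * Im w"
        unfolding arc[OF z, symmetric] by (simp add: algebra_simps)
      finally show ?thesis using R0 by (simp add: norm_mult norm_exp_eq_Re field_simps)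
    qed
    ultimately show "cmod (?f z) \<le> D * exp (s * \<kappa> * Im w) / (1 + R) / (R - cmod w)"
      unfolding norm_divide using R R0 D0 by (intro frac_le) auto
  qed (use R R0 D0 in auto)
  also have "\<dots> = (D * exp (s * \<kappa> * Im w) * pi / (R - cmod w)) * (R / (1 + R))"
    using \<open>b - a = pi\<close> pi_gt_zero by (simp add: mult_ac)
  also have "\<dots> \<le> (D * exp (s * \<kappa> * Im w) * pi / (R - cmod w)) * 1"
    using R R0 D0 by (intro mult_left_mono) auto
  finally show ?thesis by simp
qed

text \<open>Split \<open>2 \<i> sin u = exp (\<i> u) - exp (- \<i> u)\<close> with \<open>u = \<kappa> (z - w)\<close>. The first half decays in the upper half plane, the
  second in the lower one, so the segment \<open>[-R, R]\<close> is deformed into the upper semicircle for one and the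
  lower semicircle for the other. Subtracting \<open>F w / (z - w)\<close> from each half keeps both integrands entire
  even if the pole \<open>w\<close> is real; the subtracted terms add up to \<open>2 \<pi> \<i> F w\<close> over the full circle.\<close>

lemma integral_csinc_error:
  fixes F :: "complex \<Rightarrow> complex"
  assumes hol: "F holomorphic_on UNIV"
    and bound: "\<And>z. cmod (F z) * (1 + cmod z) \<le> D * exp (\<kappa> * \<bar>Im z\<bar>)"
    and R: "R > cmod w"
  shows "cmod (integral {-R..R} (\<lambda>t. 2 * \<i> * of_real \<kappa> * F (of_real t) * csinc (of_real \<kappa> * (of_real t - w)))
      - 2 * of_real pi * \<i> * F w)
    \<le> D * exp (\<kappa> * Im w) * pi / (R - cmod w) + D * exp (- \<kappa> * Im w) * pi / (R - cmod w)"
proof -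
  have R0: "R > 0" using R norm_ge_zero[of w] by linarith
  define hp where "hp z = F z * exp (\<i> * of_real \<kappa> * (z - w))" for z
  define hm where "hm z = F z * exp (- \<i> * of_real \<kappa> * (z - w))" for z
  \<comment> \<open>The second half is represented as \<open>Hp - Q\<close> and not by a quotient, so that it is entire by construction.\<close>
  define Q where "Q z = 2 * \<i> * of_real \<kappa> * F z * csinc (of_real \<kappa> * (z - w))" for z
  define Hp where "Hp z = (if z = w then deriv hp w else (hp z - hp w) / (z - w))" for z
  have "hp holomorphic_on UNIV" unfolding hp_def using hol by (intro holomorphic_intros) auto
  then have "Hp holomorphic_on UNIV" unfolding Hp_def by (rule pole_lemma_open) auto
  then obtain P where P: "\<And>z. (P has_field_derivative Hp z) (at z)"
    using holomorphic_convex_primitive'[OF convex_UNIV open_UNIV] by (metis UNIV_I)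
  have "Q holomorphic_on UNIV" unfolding Q_def using hol by (intro holomorphic_intros) auto
  then obtain PQ where PQ: "\<And>z. (PQ has_field_derivative Q z) (at z)"
    using holomorphic_convex_primitive'[OF convex_UNIV open_UNIV] by (metis UNIV_I)
  have hphm: "hp z - hm z = Q z * (z - w)" for z
  proof -
    define u where "u = of_real \<kappa> * (z - w)"
    have "Q z * (z - w) = 2 * \<i> * F z * (u * csinc u)" by (simp add: Q_def u_def)
    also have "\<dots> = F z * (2 * \<i> * sin u)" unfolding mult_csinc by simp
    also have "2 * \<i> * sin u = exp (\<i> * u) - exp (- (\<i> * u))"
      unfolding sin_exp_eq by (subst times_divide_eq_right, subst nonzero_mult_div_cancel_left) auto
    also have "F z * (exp (\<i> * u) - exp (- (\<i> * u))) = hp z - hm z"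
      by (simp add: hp_def hm_def u_def right_diff_distrib mult.assoc)
    finally show ?thesis by simp
  qed
  define A B where "A = part_circlepath 0 R 0 pi" and "B = part_circlepath 0 R pi (2 * pi)"
  have valid: "valid_path A" "valid_path B" by (auto simp: A_def B_def)
  have ends: "pathstart A = of_real R" "pathfinish A = of_real (- R)"
    "pathstart B = of_real (- R)" "pathfinish B = of_real R"
    by (simp_all add: A_def B_def exp_pi_i' exp_two_pi_i'[unfolded mult.commute[of _ 2]])
  have off: "z \<noteq> w" if "z \<in> path_image A \<or> z \<in> path_image B" for z
    using that R R0 in_path_image_part_circlepath[of z 0 R] unfolding A_def B_def by fastforce
  have intA: "contour_integral A Hp = P (of_real (- R)) - P (of_real R)"
    using contour_integral_primitive[of UNIV P Hp A] P valid ends by (intro contour_integral_unique) auto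
  have intB: "contour_integral B (\<lambda>z. Hp z - Q z) = (P (of_real R) - PQ (of_real R)) - (P (of_real (- R)) - PQ (of_real (- R)))"
    using contour_integral_primitive[of UNIV "\<lambda>z. P z - PQ z" "\<lambda>z. Hp z - Q z" B] P PQ valid ends
    by (intro contour_integral_unique) (auto intro!: derivative_eq_intros)
  have contF: "continuous_on S F" for S
    using holomorphic_on_imp_continuous_on[OF holomorphic_on_subset[OF hol]] by auto
  have ciA: "(\<lambda>z. g z / (z - w)) contour_integrable_on A" if "continuous_on (path_image A) g" for g
    unfolding A_def
    by (rule contour_integrable_continuous_part_circlepath)
      (use that off in \<open>auto intro!: continuous_intros simp: A_def\<close>)
  have ciB: "(\<lambda>z. g z / (z - w)) contour_integrable_on B" if "continuous_on (path_image B) g" for g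
    unfolding B_def
    by (rule contour_integrable_continuous_part_circlepath)
      (use that off in \<open>auto intro!: continuous_intros simp: B_def\<close>)
  have hp_ciA: "(\<lambda>z. hp z / (z - w)) contour_integrable_on A"
    unfolding hp_def by (intro ciA continuous_intros contF)
  have hm_ciB: "(\<lambda>z. hm z / (z - w)) contour_integrable_on B"
    unfolding hm_def by (intro ciB continuous_intros contF)
  have one_ciA: "(\<lambda>z. F w / (z - w)) contour_integrable_on A" by (intro ciA continuous_intros)
  have one_ciB: "(\<lambda>z. F w / (z - w)) contour_integrable_on B" by (intro ciB continuous_intros)
  have "contour_integral A Hp = contour_integral A (\<lambda>z. hp z / (z - w) - F w / (z - w))"
    by (rule contour_integral_cong) (use off in \<open>auto simp: Hp_def hp_def diff_divide_distrib\<close>)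
  also have "\<dots> = contour_integral A (\<lambda>z. hp z / (z - w)) - contour_integral A (\<lambda>z. F w / (z - w))"
    by (rule contour_integral_diff[OF hp_ciA one_ciA])
  finally have A2: "contour_integral A Hp = contour_integral A (\<lambda>z. hp z / (z - w)) - contour_integral A (\<lambda>z. F w / (z - w))" .
  have "contour_integral B (\<lambda>z. Hp z - Q z) = contour_integral B (\<lambda>z. hm z / (z - w) - F w / (z - w))"
  proof (rule contour_integral_cong)
    fix z assume "z \<in> path_image B"
    then have "z \<noteq> w" using off by blast
    then have "Q z = (hp z - hm z) / (z - w)" using hphm[of z] by simp
    then show "Hp z - Q z = hm z / (z - w) - F w / (z - w)"
      using \<open>z \<noteq> w\<close> by (simp add: Hp_def hp_def diff_divide_distrib)
  qed simp
  also have "\<dots> = contour_integral B (\<lambda>z. hm z / (z - w)) - contour_integral B (\<lambda>z. F w / (z - w))"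
    by (rule contour_integral_diff[OF hm_ciB one_ciB])
  finally have B2: "contour_integral B (\<lambda>z. Hp z - Q z) = contour_integral B (\<lambda>z. hm z / (z - w)) - contour_integral B (\<lambda>z. F w / (z - w))" .
  have on_circle: "0 + of_real R * cis t \<noteq> w" for t
  proof
    assume "0 + of_real R * cis t = w"
    then have "cmod w = \<bar>R\<bar>" by (auto simp: norm_mult)
    then show False using R R0 by simp
  qed
  have "contour_integral A (\<lambda>z. F w / (z - w)) + contour_integral B (\<lambda>z. F w / (z - w))
      = contour_integral (circlepath 0 R) (\<lambda>z. F w / (z - w))"
    unfolding A_def B_def
    by (rule integral_part_circlepath_split) (use on_circle in \<open>auto intro!: continuous_intros\<close>)
  also have "\<dots> = 2 * of_real pi * \<i> * F w"
    by (rule contour_integral_unique) (rule Cauchy_integral_circlepath_simple, use R in auto)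
  finally have full: "contour_integral A (\<lambda>z. F w / (z - w)) + contour_integral B (\<lambda>z. F w / (z - w))
      = 2 * of_real pi * \<i> * F w" .
  have "integral {-R..R} (\<lambda>t. Q (of_real t)) = PQ (of_real R) - PQ (of_real (- R))"
    by (rule integral_entire_eq_primitive[OF PQ]) (use R0 in simp)
  also have "\<dots> = - (contour_integral A Hp + contour_integral B (\<lambda>z. Hp z - Q z))"
    unfolding intA intB by simp
  also have "\<dots> = 2 * of_real pi * \<i> * F w
      - (contour_integral A (\<lambda>z. hp z / (z - w)) + contour_integral B (\<lambda>z. hm z / (z - w)))"
    unfolding A2 B2 full[symmetric] by simp
  finally have "cmod (integral {-R..R} (\<lambda>t. Q (of_real t)) - 2 * of_real pi * \<i> * F w)
      = cmod (contour_integral A (\<lambda>z. hp z / (z - w)) + contour_integral B (\<lambda>z. hm z / (z - w)))"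
    by (simp add: norm_minus_commute) (simp add: add.commute)
  also have "\<dots> \<le> cmod (contour_integral A (\<lambda>z. hp z / (z - w))) + cmod (contour_integral B (\<lambda>z. hm z / (z - w)))"
    by (rule norm_triangle_ineq)
  also have "\<dots> \<le> D * exp (\<kappa> * Im w) * pi / (R - cmod w) + D * exp (- \<kappa> * Im w) * pi / (R - cmod w)"
  proof (rule add_mono)
    have "cmod (contour_integral A (\<lambda>z. F z * exp (\<i> * of_real (1 * \<kappa>) * (z - w)) / (z - w)))
        \<le> D * exp (1 * \<kappa> * Im w) * pi / (R - cmod w)"
      unfolding A_def
    proof (rule semicircle_bound[OF hol bound R])
      fix z assume "z \<in> path_image (part_circlepath 0 R 0 pi)"
      then have "0 \<le> Im z" using R0
        by (auto simp: path_image_part_circlepath' closed_segment_eq_real_ivl intro!: mult_nonneg_nonneg sin_ge_zero)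
      then show "1 * Im z = \<bar>Im z\<bar>" by simp
    qed simp
    then show "cmod (contour_integral A (\<lambda>z. hp z / (z - w))) \<le> D * exp (\<kappa> * Im w) * pi / (R - cmod w)"
      by (simp add: hp_def)
    have "cmod (contour_integral B (\<lambda>z. F z * exp (\<i> * of_real (- 1 * \<kappa>) * (z - w)) / (z - w)))
        \<le> D * exp (- 1 * \<kappa> * Im w) * pi / (R - cmod w)"
      unfolding B_def
    proof (rule semicircle_bound[OF hol bound R])
      fix z assume "z \<in> path_image (part_circlepath 0 R pi (2 * pi))"
      then obtain t where t: "pi \<le> t" "t \<le> 2 * pi" "z = of_real R * cis t"
        using pi_gt_zero by (auto simp: path_image_part_circlepath' closed_segment_eq_real_ivl)
      have "sin t \<le> 0" using sin_le_zero[of t] t by (cases "t = 2 * pi") auto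
      then have "Im z \<le> 0" using t R0 by (simp add: mult_nonneg_nonpos)
      then show "- 1 * Im z = \<bar>Im z\<bar>" by simp
    qed simp
    then show "cmod (contour_integral B (\<lambda>z. hm z / (z - w))) \<le> D * exp (- \<kappa> * Im w) * pi / (R - cmod w)"
      by (simp add: hm_def)
  qed
  finally show ?thesis unfolding Q_def .
qed

lemma tendsto_integral_Icc_lborel:
  fixes g :: "real \<Rightarrow> complex"
  assumes "integrable lborel g"
  shows "((\<lambda>R. integral {-R..R} g) \<longlongrightarrow> (LINT t|lborel. g t)) at_top"
proof -
  have "((\<lambda>R. LINT t|lborel. indicator {-R..R} t *\<^sub>R g t) \<longlongrightarrow> (LINT t|lborel. g t)) at_top"
  proof (rule integral_dominated_convergence_at_top[where w = "\<lambda>t. norm (g t)"])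
    show "AE t in lborel. ((\<lambda>R. indicator {-R..R} t *\<^sub>R g t) \<longlongrightarrow> g t) at_top"
    proof (rule AE_I2)
      fix t :: real
      have "\<forall>\<^sub>F R in at_top. indicator {-R..R} t *\<^sub>R g t = g t"
        using eventually_ge_at_top[of "\<bar>t\<bar>"] by eventually_elim (auto simp: indicator_def)
      then show "((\<lambda>R. indicator {-R..R} t *\<^sub>R g t) \<longlongrightarrow> g t) at_top"
        by (rule tendsto_eventually)
    qed
    show "\<forall>\<^sub>F R in at_top. AE t in lborel. norm (indicator {-R..R} t *\<^sub>R g t) \<le> norm (g t)"
      by (intro always_eventually allI AE_I2) (auto split: split_indicator)
  qed (use assms in auto)
  moreover have "(LINT t|lborel. indicator {-R..R} t *\<^sub>R g t) = integral {-R..R} g" for R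
  proof -
    have "set_integrable lborel {-R..R} g"
      unfolding set_integrable_def by (intro integrable_mult_indicator assms) simp
    from set_borel_integral_eq_integral(2)[OF this] show ?thesis by (simp add: set_lebesgue_integral_def)
  qed
  ultimately show ?thesis by simp
qed

lemma integrable_inverse_one_plus_square: "integrable lborel (\<lambda>t::real. 1 / (1 + t\<^sup>2))"
  using integrable_inverse_1_plus_square by (simp add: set_integrable_def divide_inverse)

lemma one_plus_cmod_le:
  assumes "s > 0"
  shows "1 + cmod z \<le> (1 + cmod w) * (1 + 1 / s) * (1 + s * cmod (z - w))"
proof -
  have "1 + cmod z \<le> (1 + cmod w) + cmod (z - w)"
    using norm_triangle_ineq[of w "z - w"] by simp
  also have "\<dots> \<le> (1 + cmod w) + (1 + cmod w) * cmod (z - w)" by (simp add: algebra_simps)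
  also have "\<dots> = (1 + cmod w) * (1 + cmod (z - w))" by (simp add: algebra_simps)
  also have "\<dots> \<le> (1 + cmod w) * ((1 + 1 / s) * (1 + s * cmod (z - w)))"
    using assms by (intro mult_left_mono) (auto simp: field_simps)
  finally show ?thesis by (simp add: mult.assoc)
qed

text \<open>The constant depends on \<open>\<kappa>\<close> only through the lower bound \<open>s\<close>: the reproducing formula below is a limit
  over \<open>\<kappa>\<close> and requires a majorant uniform in it.\<close>

lemma csinc_shift_bound:
  assumes "s > 0"
  obtains C where "C > 0"
    "\<And>\<kappa> z. \<kappa> \<ge> s \<Longrightarrow> cmod (csinc (of_real \<kappa> * (z - w))) * (1 + cmod z) \<le> C * exp (\<kappa> * \<bar>Im w\<bar>) * exp (\<kappa> * \<bar>Im z\<bar>)"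
proof -
  obtain C where C: "C > 0" "\<And>z. cmod (csinc z) * (1 + cmod z) \<le> C * exp \<bar>Im z\<bar>"
    using csinc_bound by blast
  define E where "E = (1 + cmod w) * (1 + 1 / s)"
  have E0: "E > 0" unfolding E_def using assms by (intro mult_pos_pos add_pos_nonneg) auto
  have "cmod (csinc (of_real \<kappa> * (z - w))) * (1 + cmod z) \<le> (E * C) * exp (\<kappa> * \<bar>Im w\<bar>) * exp (\<kappa> * \<bar>Im z\<bar>)"
    if "\<kappa> \<ge> s" for \<kappa> z
  proof -
    have \<kappa>0: "\<kappa> > 0" using that assms by simp
    have "1 + cmod z \<le> E * (1 + s * cmod (z - w))" using one_plus_cmod_le[OF assms] by (simp add: E_def)
    also have "\<dots> \<le> E * (1 + cmod (of_real \<kappa> * (z - w)))"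
      using E0 that \<kappa>0 by (intro mult_left_mono) (auto simp: norm_mult mult_right_mono)
    finally have "cmod (csinc (of_real \<kappa> * (z - w))) * (1 + cmod z)
        \<le> cmod (csinc (of_real \<kappa> * (z - w))) * (E * (1 + cmod (of_real \<kappa> * (z - w))))"
      by (rule mult_left_mono) simp
    also have "\<dots> = E * (cmod (csinc (of_real \<kappa> * (z - w))) * (1 + cmod (of_real \<kappa> * (z - w))))" by simp
    also have "\<dots> \<le> E * (C * exp \<bar>Im (of_real \<kappa> * (z - w))\<bar>)"
      using E0 by (intro mult_left_mono C(2)) auto
    also have "\<dots> \<le> E * (C * exp (\<kappa> * \<bar>Im w\<bar> + \<kappa> * \<bar>Im z\<bar>))"
    proof -
      have "\<bar>Im (of_real \<kappa> * (z - w))\<bar> = \<kappa> * \<bar>Im z - Im w\<bar>" using \<kappa>0 by (simp add: abs_mult)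
      also have "\<dots> \<le> \<kappa> * (\<bar>Im w\<bar> + \<bar>Im z\<bar>)" using \<kappa>0 by (intro mult_left_mono) auto
      finally have "\<bar>Im (of_real \<kappa> * (z - w))\<bar> \<le> \<kappa> * \<bar>Im w\<bar> + \<kappa> * \<bar>Im z\<bar>" by (simp add: algebra_simps)
      then show ?thesis using E0 C(1) by simp
    qed
    finally show ?thesis by (simp add: exp_add mult.assoc)
  qed
  then show ?thesis using E0 C(1) by (intro that[of "E * C"]) auto
qed

lemma integrable_two_decays:
  fixes F G :: "real \<Rightarrow> complex"
  assumes [measurable]: "F \<in> borel_measurable lborel" "G \<in> borel_measurable lborel"
    and F: "\<And>t. cmod (F t) * (1 + \<bar>t\<bar>) \<le> A" and G: "\<And>t. cmod (G t) * (1 + \<bar>t\<bar>) \<le> B"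
  shows "integrable lborel (\<lambda>t. F t * G t)"
proof (rule Bochner_Integration.integrable_bound)
  show "integrable lborel (\<lambda>t. A * B * (1 / (1 + t\<^sup>2)))"
    using integrable_inverse_one_plus_square by (rule integrable_mult_right)
  have A0: "A \<ge> 0" using order_trans[OF _ F[of 0]] by simp
  have B0: "B \<ge> 0" using order_trans[OF _ G[of 0]] by simp
  show "AE t in lborel. norm (F t * G t) \<le> norm (A * B * (1 / (1 + t\<^sup>2)))"
  proof (rule AE_I2)
    fix t :: real
    have "norm (F t * G t) * (1 + t\<^sup>2) \<le> norm (F t * G t) * ((1 + \<bar>t\<bar>) * (1 + \<bar>t\<bar>))"
      by (intro mult_left_mono) (auto simp: power2_eq_square algebra_simps)
    also have "\<dots> = (cmod (F t) * (1 + \<bar>t\<bar>)) * (cmod (G t) * (1 + \<bar>t\<bar>))"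
      by (simp add: norm_mult)
    also have "\<dots> \<le> A * B" using A0 by (intro mult_mono F G) auto
    finally have "norm (F t * G t) \<le> A * B / (1 + t\<^sup>2)"
      by (subst pos_le_divide_eq) (auto intro: add_pos_nonneg)
    then show "norm (F t * G t) \<le> norm (A * B * (1 / (1 + t\<^sup>2)))"
      using A0 B0 by simp
  qed
qed measurable

text \<open>The reproducing formula for functions with decay, obtained by letting \<open>R \<rightarrow> \<infinity>\<close> in
  \<open>integral_csinc_error\<close>.\<close>

lemma csinc_integral_representation:
  fixes F :: "complex \<Rightarrow> complex"
  assumes hol: "F holomorphic_on UNIV"
    and bound: "\<And>z. cmod (F z) * (1 + cmod z) \<le> D * exp (\<kappa> * \<bar>Im z\<bar>)"
    and "\<kappa> > 0"
  shows "integrable lborel (\<lambda>t. F (of_real t) * csinc (of_real \<kappa> * (of_real t - w)))"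
    and "F w = of_real (\<kappa> / pi) * (LINT t|lborel. F (of_real t) * csinc (of_real \<kappa> * (of_real t - w)))"
proof -
  have contF: "continuous_on S (\<lambda>t::real. F (of_real t))" for S
    by (rule continuous_on_compose2[OF holomorphic_on_imp_continuous_on[OF hol]]) (auto intro!: continuous_intros)
  obtain C where C: "\<And>\<kappa>' z. \<kappa>' \<ge> \<kappa> \<Longrightarrow> cmod (csinc (of_real \<kappa>' * (z - w))) * (1 + cmod z)
      \<le> C * exp (\<kappa>' * \<bar>Im w\<bar>) * exp (\<kappa>' * \<bar>Im z\<bar>)"
    using csinc_shift_bound[OF \<open>\<kappa> > 0\<close>] by metis
  show int: "integrable lborel (\<lambda>t. F (of_real t) * csinc (of_real \<kappa> * (of_real t - w)))"
  proof (rule integrable_two_decays)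
    show "(\<lambda>t::real. F (of_real t)) \<in> borel_measurable lborel"
      using contF borel_measurable_continuous_onI by auto
    show "(\<lambda>t::real. csinc (of_real \<kappa> * (of_real t - w))) \<in> borel_measurable lborel"
      by (simp, intro borel_measurable_continuous_onI continuous_intros)
    show "cmod (F (of_real t)) * (1 + \<bar>t\<bar>) \<le> D" for t using bound[of "of_real t"] by simp
    show "cmod (csinc (of_real \<kappa> * (of_real t - w))) * (1 + \<bar>t\<bar>) \<le> C * exp (\<kappa> * \<bar>Im w\<bar>)" for t
      using C[of \<kappa> "of_real t"] by simp
  qed
  let ?g = "\<lambda>t. 2 * \<i> * of_real \<kappa> * F (of_real t) * csinc (of_real \<kappa> * (of_real t - w))"
  let ?E = "\<lambda>R. D * exp (\<kappa> * Im w) * pi / (R - cmod w) + D * exp (- \<kappa> * Im w) * pi / (R - cmod w)"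
  have "integrable lborel ?g"
    using integrable_mult_right[OF int, of "2 * \<i> * of_real \<kappa>"] by (simp add: mult.assoc)
  from tendsto_integral_Icc_lborel[OF this]
  have lim: "((\<lambda>R. integral {-R..R} ?g) \<longlongrightarrow> (LINT t|lborel. ?g t)) at_top" .
  have "((\<lambda>R. integral {-R..R} ?g - 2 * of_real pi * \<i> * F w) \<longlongrightarrow> 0) at_top"
  proof (rule Lim_null_comparison)
    show "\<forall>\<^sub>F R in at_top. cmod (integral {-R..R} ?g - 2 * of_real pi * \<i> * F w) \<le> ?E R"
      using eventually_gt_at_top[of "cmod w"] by eventually_elim (rule integral_csinc_error[OF hol bound])
    have f: "filterlim (\<lambda>R::real. R - cmod w) at_top at_top"
      using filterlim_tendsto_add_at_top[OF tendsto_const[of "- cmod w"] filterlim_ident] by simp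
    show "(?E \<longlongrightarrow> 0) at_top"
      using tendsto_add[OF tendsto_divide_0[OF tendsto_const filterlim_at_top_imp_at_infinity[OF f]]
          tendsto_divide_0[OF tendsto_const filterlim_at_top_imp_at_infinity[OF f]]] by simp
  qed
  then have "((\<lambda>R. integral {-R..R} ?g) \<longlongrightarrow> 2 * of_real pi * \<i> * F w) at_top"
    by (rule Lim_null[THEN iffD2])
  with lim have "(LINT t|lborel. ?g t) = 2 * of_real pi * \<i> * F w"
    by (intro tendsto_unique[OF trivial_limit_at_top_linorder])
  moreover have "(LINT t|lborel. ?g t)
      = 2 * \<i> * of_real \<kappa> * (LINT t|lborel. F (of_real t) * csinc (of_real \<kappa> * (of_real t - w)))"
    by (subst integral_mult_right_zero[symmetric]) (simp add: mult.assoc)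
  ultimately show "F w = of_real (\<kappa> / pi) * (LINT t|lborel. F (of_real t) * csinc (of_real \<kappa> * (of_real t - w)))"
    by (simp add: field_simps)
qed


text \<open>A square of a cardinal sine centred at \<open>w\<close> supplies the decay that a function in the Paley-Wiener
  space may lack, at the price of \<open>2 \<delta>\<close> in the type and without changing the value at \<open>w\<close>.\<close>

lemma exp_growth_regularized:
  fixes f :: "complex \<Rightarrow> complex"
  assumes f: "\<And>z. cmod (f z) \<le> C * ((1 + cmod z) * exp (\<mu> * \<bar>Im z\<bar>))" and "\<delta> > 0"
  obtains D where "\<And>z. cmod (f z * (csinc (of_real \<delta> * (z - w)))\<^sup>2) * (1 + cmod z) \<le> D * exp ((\<mu> + 2 * \<delta>) * \<bar>Im z\<bar>)"
proof -
  have C0: "C \<ge> 0" using order_trans[OF norm_ge_zero f[of 0]] by simp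
  obtain E where E: "E > 0" "\<And>z. cmod (csinc (of_real \<delta> * (z - w))) * (1 + cmod z) \<le> E * exp (\<delta> * \<bar>Im w\<bar>) * exp (\<delta> * \<bar>Im z\<bar>)"
    using csinc_shift_bound[OF \<open>\<delta> > 0\<close>] by (metis order_refl)
  define E' where "E' = E * exp (\<delta> * \<bar>Im w\<bar>)"
  have "cmod (f z * (csinc (of_real \<delta> * (z - w)))\<^sup>2) * (1 + cmod z) \<le> (C * E' * E') * exp ((\<mu> + 2 * \<delta>) * \<bar>Im z\<bar>)" for z
  proof -
    let ?s = "cmod (csinc (of_real \<delta> * (z - w)))"
    have s: "?s * (1 + cmod z) \<le> E' * exp (\<delta> * \<bar>Im z\<bar>)" using E(2) by (simp add: E'_def)
    have "cmod (f z * (csinc (of_real \<delta> * (z - w)))\<^sup>2) * (1 + cmod z) = cmod (f z) * (?s * ?s * (1 + cmod z))"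
      by (simp add: norm_mult norm_power power2_eq_square)
    also have "\<dots> \<le> (C * ((1 + cmod z) * exp (\<mu> * \<bar>Im z\<bar>))) * (?s * ?s * (1 + cmod z))"
      by (intro mult_right_mono f) auto
    also have "\<dots> = C * exp (\<mu> * \<bar>Im z\<bar>) * ((?s * (1 + cmod z)) * (?s * (1 + cmod z)))" by simp
    also have "\<dots> \<le> C * exp (\<mu> * \<bar>Im z\<bar>) * ((E' * exp (\<delta> * \<bar>Im z\<bar>)) * (E' * exp (\<delta> * \<bar>Im z\<bar>)))"
      using E(1) C0 by (intro mult_left_mono mult_mono[OF s s]) (auto simp: E'_def)
    also have "\<dots> = (C * E' * E') * (exp (\<mu> * \<bar>Im z\<bar>) * (exp (\<delta> * \<bar>Im z\<bar>) * exp (\<delta> * \<bar>Im z\<bar>)))" by simp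
    also have "exp (\<mu> * \<bar>Im z\<bar>) * (exp (\<delta> * \<bar>Im z\<bar>) * exp (\<delta> * \<bar>Im z\<bar>)) = exp ((\<mu> + 2 * \<delta>) * \<bar>Im z\<bar>)"
      unfolding exp_add[symmetric] by (simp add: algebra_simps)
    finally show ?thesis .
  qed
  then show ?thesis by (rule that)
qed

text \<open>A mollified reproducing kernel. Of the excess \<open>3 \<delta>\<close> in the type, one \<open>\<delta>\<close> pays for the loss in
  \<open>paley_wiener_growth\<close> and \<open>2 \<delta>\<close> for the squared cardinal sine. For \<open>\<delta> > 0\<close> the kernel decays cubically,
  hence is integrable on the real line; for \<open>\<delta> = 0\<close> it is the kernel \<open>sin (\<sigma> z) / (\<pi> z)\<close>.\<close>

definition reg_kernel :: "real \<Rightarrow> real \<Rightarrow> complex \<Rightarrow> complex" where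
  "reg_kernel \<sigma> \<delta> z = of_real ((\<sigma> + 3 * \<delta>) / pi) * (csinc (of_real \<delta> * z))\<^sup>2 * csinc (of_real (\<sigma> + 3 * \<delta>) * z)"

lemma paley_wiener_regularized_representation:
  assumes f: "f \<in> paley_wiener \<sigma>" and "\<sigma> > 0" "\<delta> > 0"
  shows "integrable lborel (\<lambda>t. f (of_real t) * reg_kernel \<sigma> \<delta> (of_real t - w))"
    and "f w = (LINT t|lborel. f (of_real t) * reg_kernel \<sigma> \<delta> (of_real t - w))"
proof -
  define F where "F z = f z * (csinc (of_real \<delta> * (z - w)))\<^sup>2" for z
  define \<kappa> where "\<kappa> = \<sigma> + 3 * \<delta>"
  have "\<kappa> > 0" using assms by (simp add: \<kappa>_def)
  have F_hol: "F holomorphic_on UNIV"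
    unfolding F_def using paley_wienerD(1)[OF f] by (intro holomorphic_intros) auto
  obtain C where "\<And>z. cmod (f z) \<le> C * ((1 + cmod z) * exp ((\<sigma> + \<delta>) * \<bar>Im z\<bar>))"
    using paley_wiener_growth[OF f, of "\<sigma> + \<delta>"] assms by auto
  from exp_growth_regularized[OF this \<open>\<delta> > 0\<close>]
  obtain D where "\<And>z. cmod (F z) * (1 + cmod z) \<le> D * exp ((\<sigma> + \<delta> + 2 * \<delta>) * \<bar>Im z\<bar>)"
    unfolding F_def by blast
  moreover have "\<sigma> + \<delta> + 2 * \<delta> = \<kappa>" by (simp add: \<kappa>_def)
  ultimately have D: "\<And>z. cmod (F z) * (1 + cmod z) \<le> D * exp (\<kappa> * \<bar>Im z\<bar>)" by simp
  note rep = csinc_integral_representation[OF F_hol D \<open>\<kappa> > 0\<close>, of w]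
  have eq: "f (of_real t) * reg_kernel \<sigma> \<delta> (of_real t - w)
      = of_real (\<kappa> / pi) * (F (of_real t) * csinc (of_real \<kappa> * (of_real t - w)))" for t
    by (simp add: reg_kernel_def F_def flip: \<kappa>_def)
  show "integrable lborel (\<lambda>t. f (of_real t) * reg_kernel \<sigma> \<delta> (of_real t - w))"
    unfolding eq by (intro integrable_mult_right rep)
  have "F w = f w" by (simp add: F_def csinc_def)
  then show "f w = (LINT t|lborel. f (of_real t) * reg_kernel \<sigma> \<delta> (of_real t - w))"
    unfolding eq integral_mult_right_zero using rep(2) by simp
qed

lemma integrable_mult_square_integrable:
  fixes u v :: "real \<Rightarrow> complex"
  assumes [measurable]: "u \<in> borel_measurable lborel" "v \<in> borel_measurable lborel"
    and u: "integrable lborel (\<lambda>t. (cmod (u t))\<^sup>2)" and v: "integrable lborel (\<lambda>t. (cmod (v t))\<^sup>2)"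
  shows "integrable lborel (\<lambda>t. u t * v t)"
proof (rule Bochner_Integration.integrable_bound)
  show "integrable lborel (\<lambda>t. (cmod (u t))\<^sup>2 + (cmod (v t))\<^sup>2)" using u v by simp
  show "AE t in lborel. norm (u t * v t) \<le> norm ((cmod (u t))\<^sup>2 + (cmod (v t))\<^sup>2)"
  proof (rule AE_I2)
    fix t
    have "2 * (cmod (u t) * cmod (v t)) \<le> (cmod (u t))\<^sup>2 + (cmod (v t))\<^sup>2"
      using sum_squares_bound[of "cmod (u t)" "cmod (v t)"] by simp
    moreover have "0 \<le> cmod (u t) * cmod (v t)" by simp
    ultimately show "norm (u t * v t) \<le> norm ((cmod (u t))\<^sup>2 + (cmod (v t))\<^sup>2)"
      unfolding norm_mult real_norm_def by linarith
  qed
qed measurable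

lemma square_integrable_of_decay:
  fixes v :: "real \<Rightarrow> complex"
  assumes [measurable]: "v \<in> borel_measurable lborel" and v: "\<And>t. cmod (v t) * (1 + \<bar>t\<bar>) \<le> B"
  shows "integrable lborel (\<lambda>t. (cmod (v t))\<^sup>2)"
  using integrable_norm[OF integrable_two_decays[OF assms(1) assms(1) v v]]
  by (simp add: norm_mult power2_eq_square)

text \<open>Conjugating \<open>w\<close> makes the kernel entire in \<open>z\<close> while the inner product, antilinear in its second
  argument, evaluates at \<open>w\<close> itself.\<close>

definition pw_kernel :: "real \<Rightarrow> complex \<Rightarrow> complex \<Rightarrow> complex" where
  "pw_kernel \<sigma> w z = of_real (\<sigma> / pi) * csinc (of_real \<sigma> * (z - cnj w))"

lemma paley_wiener_measurable:
  assumes "f \<in> paley_wiener \<sigma>"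
  shows "(\<lambda>t::real. f (of_real t)) \<in> borel_measurable lborel"
  by (simp, intro borel_measurable_continuous_onI continuous_on_compose2[OF paley_wienerD(2)[OF assms]])
    (auto intro!: continuous_intros)

lemma csinc_shift_measurable: "(\<lambda>t::real. csinc (c * (of_real t - w))) \<in> borel_measurable lborel"
  by (simp, intro borel_measurable_continuous_onI continuous_intros)

lemma pw_kernel_in_paley_wiener:
  assumes "\<sigma> > 0"
  shows "pw_kernel \<sigma> w \<in> paley_wiener \<sigma>"
proof -
  obtain C where C: "C > 0" "\<And>\<kappa> z. \<kappa> \<ge> \<sigma> \<Longrightarrow> cmod (csinc (of_real \<kappa> * (z - cnj w))) * (1 + cmod z)
      \<le> C * exp (\<kappa> * \<bar>Im (cnj w)\<bar>) * exp (\<kappa> * \<bar>Im z\<bar>)"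
    using csinc_shift_bound[OF assms] by metis
  define B where "B = \<sigma> / pi * C * exp (\<sigma> * \<bar>Im (cnj w)\<bar>)"
  have B0: "B > 0" using assms C pi_gt_zero by (simp add: B_def)
  have B: "cmod (pw_kernel \<sigma> w z) * (1 + cmod z) \<le> B * exp (\<sigma> * \<bar>Im z\<bar>)" for z
  proof -
    have "cmod (pw_kernel \<sigma> w z) * (1 + cmod z) = \<sigma> / pi * (cmod (csinc (of_real \<sigma> * (z - cnj w))) * (1 + cmod z))"
      using assms by (simp add: pw_kernel_def norm_mult norm_divide)
    also have "\<dots> \<le> \<sigma> / pi * (C * exp (\<sigma> * \<bar>Im (cnj w)\<bar>) * exp (\<sigma> * \<bar>Im z\<bar>))"
      using assms C(2)[of \<sigma> z] by (intro mult_left_mono) auto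
    finally show ?thesis by (simp add: B_def mult.assoc)
  qed
  have "pw_kernel \<sigma> w holomorphic_on UNIV"
    unfolding pw_kernel_def by (intro holomorphic_intros)
  moreover have "exp_type_le \<sigma> (pw_kernel \<sigma> w)"
    unfolding exp_type_le_def
  proof (intro allI impI exI)
    fix \<epsilon> :: real and z assume "\<epsilon> > 0"
    have "cmod (pw_kernel \<sigma> w z) * 1 \<le> cmod (pw_kernel \<sigma> w z) * (1 + cmod z)"
      by (intro mult_left_mono) auto
    also note B[of z]
    also have "B * exp (\<sigma> * \<bar>Im z\<bar>) \<le> B * exp ((\<sigma> + \<epsilon>) * cmod z)"
    proof -
      have "\<sigma> * \<bar>Im z\<bar> \<le> (\<sigma> + \<epsilon>) * cmod z"
        using assms \<open>\<epsilon> > 0\<close> abs_Im_le_cmod[of z] by (intro mult_mono) auto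
      then show ?thesis using B0 by simp
    qed
    finally show "cmod (pw_kernel \<sigma> w z) \<le> B * exp ((\<sigma> + \<epsilon>) * cmod z)" by simp
  qed
  moreover have "integrable lborel (\<lambda>t::real. (cmod (pw_kernel \<sigma> w (of_real t)))\<^sup>2)"
  proof (rule square_integrable_of_decay)
    show "(\<lambda>t::real. pw_kernel \<sigma> w (of_real t)) \<in> borel_measurable lborel"
      unfolding pw_kernel_def using csinc_shift_measurable by measurable
    show "cmod (pw_kernel \<sigma> w (of_real t)) * (1 + \<bar>t\<bar>) \<le> B" for t
      using B[of "of_real t"] by simp
  qed
  ultimately show ?thesis by (simp add: paley_wiener_def)
qed

lemma cnj_pw_kernel_of_real:
  "cnj (pw_kernel \<sigma> w (of_real t)) = of_real (\<sigma> / pi) * csinc (of_real \<sigma> * (of_real t - w))"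
  by (simp add: pw_kernel_def cnj_csinc)

text \<open>The mollified formula holds for each \<open>\<delta> > 0\<close>; now \<open>\<delta> \<rightarrow> 0\<close>. The integrands are dominated by
  \<open>\<bar>f t\<bar> B / (1 + \<bar>t\<bar>)\<close>, a product of two square-integrable functions.\<close>

theorem paley_wiener_reproducing:
  assumes f: "f \<in> paley_wiener \<sigma>" and "\<sigma> > 0"
  shows "f w = pw_inner f (pw_kernel \<sigma> w)"
proof -
  define \<delta> where "\<delta> n = 1 / real (Suc n)" for n
  have \<delta>: "0 < \<delta> n" "\<delta> n \<le> 1" for n by (simp_all add: \<delta>_def)
  have \<delta>_lim: "\<delta> \<longlonglongrightarrow> 0" unfolding \<delta>_def by (rule LIMSEQ_Suc[OF lim_const_over_n])
  obtain C where C: "C > 0" "\<And>z. cmod (csinc z) * (1 + cmod z) \<le> C * exp \<bar>Im z\<bar>"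
    using csinc_bound by blast
  obtain E where E: "E > 0" "\<And>\<kappa> z. \<kappa> \<ge> \<sigma> \<Longrightarrow> cmod (csinc (of_real \<kappa> * (z - w))) * (1 + cmod z)
      \<le> E * exp (\<kappa> * \<bar>Im w\<bar>) * exp (\<kappa> * \<bar>Im z\<bar>)"
    using csinc_shift_bound[OF \<open>\<sigma> > 0\<close>] by metis
  define B where "B = (\<sigma> + 3) / pi * (C * exp \<bar>Im w\<bar>)\<^sup>2 * (E * exp ((\<sigma> + 3) * \<bar>Im w\<bar>))"
  have B0: "B \<ge> 0" unfolding B_def using \<open>\<sigma> > 0\<close> C(1) E(1) by (intro mult_nonneg_nonneg) auto
  have ker: "cmod (reg_kernel \<sigma> (\<delta> n) (of_real t - w)) * (1 + \<bar>t\<bar>) \<le> B" for n t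
  proof -
    have 1: "cmod (csinc (of_real (\<delta> n) * (of_real t - w))) \<le> C * exp \<bar>Im w\<bar>"
    proof -
      have "cmod (csinc (of_real (\<delta> n) * (of_real t - w))) * 1
          \<le> cmod (csinc (of_real (\<delta> n) * (of_real t - w))) * (1 + cmod (of_real (\<delta> n) * (of_real t - w)))"
        by (intro mult_left_mono) auto
      also note C(2)
      also have "\<bar>Im (of_real (\<delta> n) * (of_real t - w))\<bar> \<le> \<bar>Im w\<bar>"
        using \<delta>[of n] by (simp add: abs_mult mult_left_le_one_le)
      then have "C * exp \<bar>Im (of_real (\<delta> n) * (of_real t - w))\<bar> \<le> C * exp \<bar>Im w\<bar>" using C(1) by simp
      finally show ?thesis by simp
    qed
    have 2: "cmod (csinc (of_real (\<sigma> + 3 * \<delta> n) * (of_real t - w))) * (1 + \<bar>t\<bar>) \<le> E * exp ((\<sigma> + 3) * \<bar>Im w\<bar>)"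
    proof -
      have "cmod (csinc (of_real (\<sigma> + 3 * \<delta> n) * (of_real t - w))) * (1 + \<bar>t\<bar>) \<le> E * exp ((\<sigma> + 3 * \<delta> n) * \<bar>Im w\<bar>)"
        using E(2)[of "\<sigma> + 3 * \<delta> n" "of_real t"] \<delta>[of n] by simp
      also have "\<dots> \<le> E * exp ((\<sigma> + 3) * \<bar>Im w\<bar>)"
        using E(1) \<delta>[of n] by (simp add: mult_right_mono)
      finally show ?thesis .
    qed
    have 3: "cmod (of_real ((\<sigma> + 3 * \<delta> n) / pi)) \<le> (\<sigma> + 3) / pi"
      using \<open>\<sigma> > 0\<close> \<delta>[of n] unfolding norm_of_real by (simp add: divide_right_mono)
    have "cmod (reg_kernel \<sigma> (\<delta> n) (of_real t - w)) * (1 + \<bar>t\<bar>)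
       = cmod (of_real ((\<sigma> + 3 * \<delta> n) / pi)) * (cmod (csinc (of_real (\<delta> n) * (of_real t - w))))\<^sup>2
         * (cmod (csinc (of_real (\<sigma> + 3 * \<delta> n) * (of_real t - w))) * (1 + \<bar>t\<bar>))"
      unfolding reg_kernel_def norm_mult norm_power by (simp only: mult.assoc)
    also have "\<dots> \<le> B"
      unfolding B_def using \<open>\<sigma> > 0\<close> C(1) by (intro mult_mono 1 2 3 power_mono) auto
    finally show ?thesis .
  qed
  have ker_meas: "(\<lambda>t::real. reg_kernel \<sigma> d (of_real t - w)) \<in> borel_measurable lborel" for d
    unfolding reg_kernel_def using csinc_shift_measurable by measurable
  let ?dom = "\<lambda>t::real. of_real B / (1 + of_real \<bar>t\<bar>) :: complex"
  have dom_meas: "?dom \<in> borel_measurable lborel" by measurable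
  have "(\<lambda>n. LINT t|lborel. f (of_real t) * reg_kernel \<sigma> (\<delta> n) (of_real t - w))
      \<longlonglongrightarrow> (LINT t|lborel. f (of_real t) * cnj (pw_kernel \<sigma> w (of_real t)))"
  proof (rule integral_dominated_convergence[where w = "\<lambda>t. norm (f (of_real t) * ?dom t)"])
    show "(\<lambda>t. f (of_real t) * cnj (pw_kernel \<sigma> w (of_real t))) \<in> borel_measurable lborel"
      unfolding cnj_pw_kernel_of_real
      using paley_wiener_measurable[OF f] csinc_shift_measurable by measurable
    show "(\<lambda>t. f (of_real t) * reg_kernel \<sigma> (\<delta> n) (of_real t - w)) \<in> borel_measurable lborel" for n
      using paley_wiener_measurable[OF f] ker_meas by measurable
    have "cmod (?dom t) * (1 + \<bar>t\<bar>) \<le> B" for t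
    proof -
      have "cmod (1 + complex_of_real \<bar>t\<bar>) = 1 + \<bar>t\<bar>"
        using norm_of_real[of "1 + \<bar>t\<bar>", where 'a = complex] by simp
      then show ?thesis using B0 by (simp add: norm_divide)
    qed
    then have "integrable lborel (\<lambda>t. (cmod (?dom t))\<^sup>2)"
      by (rule square_integrable_of_decay[OF dom_meas])
    then show "integrable lborel (\<lambda>t. norm (f (of_real t) * ?dom t))"
      by (intro integrable_norm integrable_mult_square_integrable paley_wiener_measurable[OF f] dom_meas
          paley_wienerD(4)[OF f])
    show "AE t in lborel. norm (f (of_real t) * reg_kernel \<sigma> (\<delta> n) (of_real t - w)) \<le> norm (f (of_real t) * ?dom t)" for n
    proof (rule AE_I2)
      fix t :: real
      have "cmod (1 + complex_of_real \<bar>t\<bar>) = 1 + \<bar>t\<bar>"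
        using norm_of_real[of "1 + \<bar>t\<bar>", where 'a = complex] by simp
      then have "cmod (?dom t) = B / (1 + \<bar>t\<bar>)" using B0 by (simp add: norm_divide)
      moreover have "cmod (reg_kernel \<sigma> (\<delta> n) (of_real t - w)) \<le> B / (1 + \<bar>t\<bar>)"
        using ker[of n t] by (subst pos_le_divide_eq) auto
      ultimately show "norm (f (of_real t) * reg_kernel \<sigma> (\<delta> n) (of_real t - w)) \<le> norm (f (of_real t) * ?dom t)"
        unfolding norm_mult by (intro mult_left_mono) auto
    qed
    show "AE t in lborel. (\<lambda>n. f (of_real t) * reg_kernel \<sigma> (\<delta> n) (of_real t - w))
        \<longlonglongrightarrow> f (of_real t) * cnj (pw_kernel \<sigma> w (of_real t))"
    proof (rule AE_I2)
      fix t :: real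
      have cs: "isCont csinc z" for z
        using holomorphic_on_imp_continuous_on[OF holomorphic_csinc] by (simp add: continuous_on_eq_continuous_at)
      have "(\<lambda>n. f (of_real t) * reg_kernel \<sigma> (\<delta> n) (of_real t - w))
        \<longlonglongrightarrow> f (of_real t) * (of_real ((\<sigma> + 3 * 0) / pi) * (csinc (of_real 0 * (of_real t - w)))\<^sup>2
            * csinc (of_real (\<sigma> + 3 * 0) * (of_real t - w)))"
        unfolding reg_kernel_def
        by (intro tendsto_intros \<delta>_lim isCont_tendsto_compose[OF cs]) auto
      then show "(\<lambda>n. f (of_real t) * reg_kernel \<sigma> (\<delta> n) (of_real t - w))
        \<longlonglongrightarrow> f (of_real t) * cnj (pw_kernel \<sigma> w (of_real t))"
        unfolding cnj_pw_kernel_of_real by (simp add: csinc_def[of 0])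
    qed
  qed
  moreover have "(LINT t|lborel. f (of_real t) * reg_kernel \<sigma> (\<delta> n) (of_real t - w)) = f w" for n
    using paley_wiener_regularized_representation(2)[OF f \<open>\<sigma> > 0\<close> \<delta>(1)] by simp
  ultimately show ?thesis
    unfolding pw_inner_def using LIMSEQ_unique[OF tendsto_const] by simp
qed

section \<open>The inner product space\<close>

lemma exp_type_leE:
  assumes "exp_type_le \<sigma> f" "\<epsilon> > 0"
  obtains C where "C \<ge> 0" "\<And>z. cmod (f z) \<le> C * exp ((\<sigma> + \<epsilon>) * cmod z)"
proof -
  obtain C where C: "\<And>z. cmod (f z) \<le> C * exp ((\<sigma> + \<epsilon>) * cmod z)"
    using assms unfolding exp_type_le_def by blast
  then show ?thesis using that[of C] order_trans[OF norm_ge_zero C[of 0]] by simp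
qed

lemma paley_wiener_scaleF:
  assumes f: "f \<in> paley_wiener \<sigma>"
  shows "scaleF c f \<in> paley_wiener \<sigma>"
proof -
  have "exp_type_le \<sigma> (scaleF c f)"
    unfolding exp_type_le_def
  proof (intro allI impI)
    fix \<epsilon> :: real assume "\<epsilon> > 0"
    with paley_wienerD(3)[OF f] obtain C where C: "\<And>z. cmod (f z) \<le> C * exp ((\<sigma> + \<epsilon>) * cmod z)"
      unfolding exp_type_le_def by blast
    have "cmod (scaleF c f z) \<le> (cmod c * C) * exp ((\<sigma> + \<epsilon>) * cmod z)" for z
      using mult_left_mono[OF C[of z] norm_ge_zero[of c]] by (simp add: scaleF_def norm_mult)
    then show "\<exists>C. \<forall>z. cmod (scaleF c f z) \<le> C * exp ((\<sigma> + \<epsilon>) * cmod z)" by blast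
  qed
  moreover have "scaleF c f holomorphic_on UNIV"
    unfolding scaleF_def using paley_wienerD(1)[OF f] by (intro holomorphic_intros) auto
  moreover have "integrable lborel (\<lambda>t::real. (cmod (scaleF c f (of_real t)))\<^sup>2)"
    using paley_wienerD(4)[OF f] by (simp add: scaleF_def norm_mult power_mult_distrib)
  ultimately show ?thesis by (simp add: paley_wiener_def)
qed

lemma paley_wiener_add:
  assumes f: "f \<in> paley_wiener \<sigma>" and g: "g \<in> paley_wiener \<sigma>"
  shows "f + g \<in> paley_wiener \<sigma>"
proof -
  have "exp_type_le \<sigma> (f + g)"
    unfolding exp_type_le_def
  proof (intro allI impI)
    fix \<epsilon> :: real assume "\<epsilon> > 0"
    obtain C where C: "\<And>z. cmod (f z) \<le> C * exp ((\<sigma> + \<epsilon>) * cmod z)"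
      using exp_type_leE[OF paley_wienerD(3)[OF f] \<open>\<epsilon> > 0\<close>] by metis
    obtain D where D: "\<And>z. cmod (g z) \<le> D * exp ((\<sigma> + \<epsilon>) * cmod z)"
      using exp_type_leE[OF paley_wienerD(3)[OF g] \<open>\<epsilon> > 0\<close>] by metis
    have "cmod ((f + g) z) \<le> (C + D) * exp ((\<sigma> + \<epsilon>) * cmod z)" for z
      using norm_triangle_ineq[of "f z" "g z"] C[of z] D[of z] by (simp add: algebra_simps)
    then show "\<exists>C. \<forall>z. cmod ((f + g) z) \<le> C * exp ((\<sigma> + \<epsilon>) * cmod z)" by blast
  qed
  moreover have "f + g holomorphic_on UNIV"
    unfolding plus_fun_def using paley_wienerD(1)[OF f] paley_wienerD(1)[OF g] by (intro holomorphic_intros)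
  moreover have "integrable lborel (\<lambda>t::real. (cmod ((f + g) (of_real t)))\<^sup>2)"
  proof (rule Bochner_Integration.integrable_bound)
    show "integrable lborel (\<lambda>t::real. 2 * (cmod (f (of_real t)))\<^sup>2 + 2 * (cmod (g (of_real t)))\<^sup>2)"
      using paley_wienerD(4)[OF f] paley_wienerD(4)[OF g] by simp
    show "AE t in lborel. norm ((cmod ((f + g) (of_real t)))\<^sup>2)
        \<le> norm (2 * (cmod (f (of_real t)))\<^sup>2 + 2 * (cmod (g (of_real t)))\<^sup>2)"
    proof (rule AE_I2)
      fix t :: real
      let ?x = "cmod (f (of_real t))" and ?y = "cmod (g (of_real t))"
      have "(cmod ((f + g) (of_real t)))\<^sup>2 \<le> (?x + ?y)\<^sup>2"
        using norm_triangle_ineq by (intro power_mono) auto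
      also have "\<dots> \<le> 2 * ?x\<^sup>2 + 2 * ?y\<^sup>2"
        using sum_squares_bound[of ?x ?y] by (simp add: power2_sum)
      finally show "norm ((cmod ((f + g) (of_real t)))\<^sup>2) \<le> norm (2 * ?x\<^sup>2 + 2 * ?y\<^sup>2)" by simp
    qed
    have "(\<lambda>t::real. f (of_real t) + g (of_real t)) \<in> borel_measurable lborel"
      using paley_wiener_measurable[OF f] paley_wiener_measurable[OF g] by measurable
    then show "(\<lambda>t::real. (cmod ((f + g) (of_real t)))\<^sup>2) \<in> borel_measurable lborel"
      unfolding plus_fun_apply by measurable
  qed
  ultimately show ?thesis by (simp add: paley_wiener_def)
qed

text \<open>Reduces each statement about differences to those about sums and multiples.\<close>

lemma diff_eq_add_scaleF: "f - g = f + scaleF (- 1) g"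
  by (simp add: fun_eq_iff scaleF_def)

lemma paley_wiener_diff:
  assumes "f \<in> paley_wiener \<sigma>" "g \<in> paley_wiener \<sigma>"
  shows "f - g \<in> paley_wiener \<sigma>"
  unfolding diff_eq_add_scaleF by (intro paley_wiener_add paley_wiener_scaleF assms)

lemma paley_wiener_zero: "0 \<in> paley_wiener \<sigma>"
  by (auto simp: paley_wiener_def exp_type_le_def zero_fun_def intro!: exI[of _ 0])

lemma paley_wiener_subspace: "cfun.subspace (paley_wiener \<sigma>)"
  by (auto simp: cfun.subspace_def paley_wiener_add paley_wiener_scaleF paley_wiener_zero)

lemma paley_wiener_mono:
  assumes f: "f \<in> paley_wiener \<tau>" and "\<tau> \<le> \<sigma>"
  shows "f \<in> paley_wiener \<sigma>"
proof -
  have "exp_type_le \<sigma> f"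
    unfolding exp_type_le_def
  proof (intro allI impI)
    fix \<epsilon> :: real assume "\<epsilon> > 0"
    obtain C where C: "C \<ge> 0" "\<And>z. cmod (f z) \<le> C * exp ((\<tau> + \<epsilon>) * cmod z)"
      using exp_type_leE[OF paley_wienerD(3)[OF f] \<open>\<epsilon> > 0\<close>] by blast
    have "cmod (f z) \<le> C * exp ((\<sigma> + \<epsilon>) * cmod z)" for z
      using C(1) \<open>\<tau> \<le> \<sigma>\<close> by (intro order_trans[OF C(2)] mult_left_mono) (auto intro!: mult_right_mono)
    then show "\<exists>C. \<forall>z. cmod (f z) \<le> C * exp ((\<sigma> + \<epsilon>) * cmod z)" by blast
  qed
  then show ?thesis using paley_wienerD[OF f] by (simp add: paley_wiener_def)
qed

lemma pw_inner_integrable: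
  assumes "f \<in> paley_wiener \<sigma>" "g \<in> paley_wiener \<sigma>"
  shows "integrable lborel (\<lambda>t::real. f (of_real t) * cnj (g (of_real t)))"
proof -
  have "(\<lambda>t::real. cnj (g (of_real t))) \<in> borel_measurable lborel"
    using borel_measurable_continuous_on[OF continuous_on_cnj[OF continuous_on_id] paley_wiener_measurable[OF assms(2)]] by simp
  then show ?thesis
    using paley_wienerD(4)[OF assms(1)] paley_wienerD(4)[OF assms(2)]
    by (intro integrable_mult_square_integrable paley_wiener_measurable[OF assms(1)]) auto
qed

lemma pw_inner_add_left:
  assumes "f \<in> paley_wiener \<sigma>" "g \<in> paley_wiener \<sigma>" "h \<in> paley_wiener \<sigma>"
  shows "pw_inner (f + g) h = pw_inner f h + pw_inner g h"
  unfolding pw_inner_def using pw_inner_integrable[OF assms(1,3)] pw_inner_integrable[OF assms(2,3)]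
  by (simp add: distrib_right)

lemma pw_inner_scaleF_left: "pw_inner (scaleF c f) h = c * pw_inner f h"
  unfolding pw_inner_def by (simp add: scaleF_def mult.assoc)

lemma pw_inner_commute: "pw_inner g f = cnj (pw_inner f g)"
proof -
  have "pw_inner g f = (LINT t|lborel. cnj (f (of_real (t::real)) * cnj (g (of_real t))))"
    by (simp add: pw_inner_def mult.commute)
  also have "\<dots> = cnj (pw_inner f g)" unfolding pw_inner_def by (rule integral_bounded_linear'[OF bounded_linear_cnj bounded_linear_cnj]) simp
  finally show ?thesis .
qed

lemma pw_inner_diff_left:
  assumes "f \<in> paley_wiener \<sigma>" "g \<in> paley_wiener \<sigma>" "h \<in> paley_wiener \<sigma>"
  shows "pw_inner (f - g) h = pw_inner f h - pw_inner g h"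
  unfolding diff_eq_add_scaleF pw_inner_add_left[OF assms(1) paley_wiener_scaleF[OF assms(2)] assms(3)]
    pw_inner_scaleF_left by simp

lemma pw_inner_add_right:
  assumes "f \<in> paley_wiener \<sigma>" "g \<in> paley_wiener \<sigma>" "h \<in> paley_wiener \<sigma>"
  shows "pw_inner h (f + g) = pw_inner h f + pw_inner h g"
  unfolding pw_inner_commute[of h] pw_inner_add_left[OF assms] by simp

lemma pw_inner_scaleF_right: "pw_inner h (scaleF c f) = cnj c * pw_inner h f"
  unfolding pw_inner_commute[of h] pw_inner_scaleF_left by simp

lemma pw_inner_diff_right:
  assumes "f \<in> paley_wiener \<sigma>" "g \<in> paley_wiener \<sigma>" "h \<in> paley_wiener \<sigma>"
  shows "pw_inner h (f - g) = pw_inner h f - pw_inner h g"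
  unfolding pw_inner_commute[of h] pw_inner_diff_left[OF assms] by simp

lemma pw_norm_nonneg: "pw_norm f \<ge> 0"
  by (simp add: pw_norm_def integral_nonneg_AE)

lemma pw_norm_square: "(pw_norm f)\<^sup>2 = (LINT t|lborel. (cmod (f (of_real (t::real))))\<^sup>2)"
  by (simp add: pw_norm_def integral_nonneg_AE)

lemma pw_inner_self: "pw_inner f f = of_real ((pw_norm f)\<^sup>2)"
proof -
  have "pw_inner f f = (LINT t|lborel. complex_of_real ((cmod (f (of_real (t::real))))\<^sup>2))"
    unfolding pw_inner_def complex_norm_square ..
  then show ?thesis unfolding pw_norm_square integral_complex_of_real .
qed

text \<open>A vanishing integral only gives \<open>f = 0\<close> almost everywhere on the real line; the reproducing formula
  spreads this to the whole plane.\<close>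

lemma pw_norm_eq_0D:
  assumes f: "f \<in> paley_wiener \<sigma>" and "\<sigma> > 0" "pw_norm f = 0"
  shows "f = 0"
proof
  fix w
  have "(LINT t|lborel. (cmod (f (of_real (t::real))))\<^sup>2) = 0"
    using assms(3) pw_norm_square[of f] by simp
  then have "AE t in lborel. (cmod (f (of_real t)))\<^sup>2 = 0"
    using integral_nonneg_eq_0_iff_AE[OF paley_wienerD(4)[OF f]] by simp
  then have "AE t in lborel. f (of_real t) * cnj (pw_kernel \<sigma> w (of_real t)) = 0"
    by eventually_elim simp
  then have "pw_inner f (pw_kernel \<sigma> w) = 0"
    unfolding pw_inner_def by (rule integral_eq_zero_AE)
  then show "f w = 0 w" using paley_wiener_reproducing[OF f \<open>\<sigma> > 0\<close>] by simp
qed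

lemma pw_norm_square_add:
  assumes "f \<in> paley_wiener \<sigma>" "g \<in> paley_wiener \<sigma>"
  shows "(pw_norm (f + g))\<^sup>2 = (pw_norm f)\<^sup>2 + 2 * Re (pw_inner f g) + (pw_norm g)\<^sup>2"
proof -
  have "complex_of_real ((pw_norm (f + g))\<^sup>2) = pw_inner f f + pw_inner f g + (cnj (pw_inner f g) + pw_inner g g)"
    unfolding pw_inner_self[symmetric] using assms
    by (simp add: pw_inner_add_left[of f \<sigma> g] pw_inner_add_right[of f \<sigma> g] paley_wiener_add pw_inner_commute[of g f])
  also have "\<dots> = of_real ((pw_norm f)\<^sup>2 + 2 * Re (pw_inner f g) + (pw_norm g)\<^sup>2)"
    by (simp add: pw_inner_self complex_eq_iff)
  finally show ?thesis unfolding of_real_eq_iff .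
qed

lemma pw_norm_scaleF: "pw_norm (scaleF c f) = cmod c * pw_norm f"
proof (rule power2_eq_imp_eq)
  show "(pw_norm (scaleF c f))\<^sup>2 = (cmod c * pw_norm f)\<^sup>2"
    unfolding power_mult_distrib pw_norm_square by (simp add: scaleF_def norm_mult power_mult_distrib)
qed (auto simp: pw_norm_nonneg)

lemma pw_norm_minus_commute: "pw_norm (f - g) = pw_norm (g - f)"
  by (simp add: pw_norm_def norm_minus_commute)

lemma pw_norm_square_diff:
  assumes "f \<in> paley_wiener \<sigma>" "g \<in> paley_wiener \<sigma>"
  shows "(pw_norm (f - g))\<^sup>2 = (pw_norm f)\<^sup>2 - 2 * Re (pw_inner f g) + (pw_norm g)\<^sup>2"
  unfolding diff_eq_add_scaleF pw_norm_square_add[OF assms(1) paley_wiener_scaleF[OF assms(2)]]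
    pw_inner_scaleF_right pw_norm_scaleF by simp

lemma pw_Cauchy_Schwarz:
  assumes f: "f \<in> paley_wiener \<sigma>" and g: "g \<in> paley_wiener \<sigma>" and "\<sigma> > 0"
  shows "cmod (pw_inner f g) \<le> pw_norm f * pw_norm g"
proof (cases "pw_norm g = 0")
  case True
  then have "g = 0" using pw_norm_eq_0D g \<open>\<sigma> > 0\<close> by blast
  then show ?thesis using True by (simp add: pw_inner_def)
next
  case False
  define n where "n = (pw_norm g)\<^sup>2"
  have "n > 0" using False by (simp add: n_def)
  define c where "c = pw_inner f g / of_real n"
  have "Re (cnj c * pw_inner f g) = (cmod (pw_inner f g))\<^sup>2 / n"
  proof -
    have "cnj c * pw_inner f g = of_real ((cmod (pw_inner f g))\<^sup>2 / n)"
      using complex_norm_square[of "pw_inner f g"] by (simp add: c_def mult.commute)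
    then show ?thesis by simp
  qed
  moreover have "(cmod c)\<^sup>2 * n = (cmod (pw_inner f g))\<^sup>2 / n"
    using \<open>n > 0\<close> by (simp add: c_def norm_divide power_divide power2_eq_square)
  moreover have "(pw_norm (f - scaleF c g))\<^sup>2 = (pw_norm f)\<^sup>2 - 2 * Re (cnj c * pw_inner f g) + (cmod c)\<^sup>2 * n"
    by (subst pw_norm_square_diff[OF f paley_wiener_scaleF[OF g]])
      (simp add: pw_inner_scaleF_right pw_norm_scaleF power_mult_distrib n_def)
  moreover have "(pw_norm (f - scaleF c g))\<^sup>2 \<ge> 0" by simp
  ultimately have "(cmod (pw_inner f g))\<^sup>2 / n \<le> (pw_norm f)\<^sup>2" by linarith
  then have "(cmod (pw_inner f g))\<^sup>2 \<le> (pw_norm f * pw_norm g)\<^sup>2"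
    using \<open>n > 0\<close> by (simp add: n_def field_simps power_mult_distrib)
  then show ?thesis by (rule power2_le_imp_le) (simp add: pw_norm_nonneg)
qed

lemma pw_norm_triangle:
  assumes "f \<in> paley_wiener \<sigma>" "g \<in> paley_wiener \<sigma>" "\<sigma> > 0"
  shows "pw_norm (f + g) \<le> pw_norm f + pw_norm g"
proof (rule power2_le_imp_le)
  have "Re (pw_inner f g) \<le> pw_norm f * pw_norm g"
    using pw_Cauchy_Schwarz[OF assms] complex_Re_le_cmod order_trans by blast
  then show "(pw_norm (f + g))\<^sup>2 \<le> (pw_norm f + pw_norm g)\<^sup>2"
    using pw_norm_square_add[OF assms(1,2)] by (simp add: power2_sum)
qed (simp add: pw_norm_nonneg)

section \<open>Completeness\<close>

text \<open>Point evaluations are bounded by the norm of the kernel, and \<open>\<parallel>K w\<parallel>\<^sup>2 = \<langle>K w, K w\<rangle> = K w w\<close> is explicit. The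
  constant is uniform on horizontal strips, and its growth in \<open>Im w\<close> is that of type \<open>\<sigma>\<close>; this preserves
  the exponential type under limits.\<close>

lemma paley_wiener_pointwise_bound:
  assumes "\<sigma> > 0"
  obtains A where "A > 0"
    "\<And>f w. f \<in> paley_wiener \<sigma> \<Longrightarrow> cmod (f w) \<le> A * exp (\<sigma> * \<bar>Im w\<bar>) * pw_norm f"
proof -
  obtain C where C: "C > 0" "\<And>z. cmod (csinc z) * (1 + cmod z) \<le> C * exp \<bar>Im z\<bar>"
    using csinc_bound by blast
  define A where "A = sqrt (\<sigma> / pi * C)"
  have A0: "A > 0" using assms C(1) pi_gt_zero by (simp add: A_def)
  have norm_kernel: "pw_norm (pw_kernel \<sigma> w) \<le> A * exp (\<sigma> * \<bar>Im w\<bar>)" for w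
  proof (rule power2_le_imp_le)
    have "complex_of_real ((pw_norm (pw_kernel \<sigma> w))\<^sup>2) = pw_kernel \<sigma> w w"
      unfolding pw_inner_self[symmetric]
      using paley_wiener_reproducing[OF pw_kernel_in_paley_wiener[OF assms] assms] by simp
    from arg_cong[OF this, of cmod] have "(pw_norm (pw_kernel \<sigma> w))\<^sup>2 = cmod (pw_kernel \<sigma> w w)"
      unfolding norm_of_real by simp
    also have "\<dots> = \<sigma> / pi * cmod (csinc (of_real \<sigma> * (w - cnj w)))"
      using assms by (simp add: pw_kernel_def norm_mult norm_divide)
    also have "\<dots> \<le> \<sigma> / pi * (C * exp (2 * \<sigma> * \<bar>Im w\<bar>))"
    proof (rule mult_left_mono)
      have "cmod (csinc (of_real \<sigma> * (w - cnj w))) * 1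
          \<le> cmod (csinc (of_real \<sigma> * (w - cnj w))) * (1 + cmod (of_real \<sigma> * (w - cnj w)))"
        by (intro mult_left_mono) auto
      also note C(2)
      also have "\<bar>Im (of_real \<sigma> * (w - cnj w))\<bar> = 2 * \<sigma> * \<bar>Im w\<bar>" using assms by (simp add: abs_mult)
      finally show "cmod (csinc (of_real \<sigma> * (w - cnj w))) \<le> C * exp (2 * \<sigma> * \<bar>Im w\<bar>)" by simp
    qed (use assms in auto)
    also have "\<dots> = (A * exp (\<sigma> * \<bar>Im w\<bar>))\<^sup>2"
      using assms C(1) by (simp add: A_def power_mult_distrib exp_double[symmetric] mult.assoc)
    finally show "(pw_norm (pw_kernel \<sigma> w))\<^sup>2 \<le> (A * exp (\<sigma> * \<bar>Im w\<bar>))\<^sup>2" .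
  qed (use A0 in auto)
  have "cmod (f w) \<le> A * exp (\<sigma> * \<bar>Im w\<bar>) * pw_norm f" if f: "f \<in> paley_wiener \<sigma>" for f w
  proof -
    have "cmod (f w) \<le> pw_norm f * pw_norm (pw_kernel \<sigma> w)"
      using pw_Cauchy_Schwarz[OF f pw_kernel_in_paley_wiener[OF assms] assms]
        paley_wiener_reproducing[OF f assms, of w] by simp
    also have "\<dots> \<le> pw_norm f * (A * exp (\<sigma> * \<bar>Im w\<bar>))"
      by (intro mult_left_mono norm_kernel pw_norm_nonneg)
    finally show ?thesis by (simp add: mult.commute)
  qed
  with A0 show ?thesis by (rule that)
qed

lemma nn_integral_pw_norm:
  assumes "f \<in> paley_wiener \<sigma>"
  shows "(\<integral>\<^sup>+t. ennreal ((cmod (f (of_real t)))\<^sup>2) \<partial>lborel) = ennreal ((pw_norm f)\<^sup>2)"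
  unfolding pw_norm_square by (rule nn_integral_eq_integral[OF paley_wienerD(4)[OF assms]]) simp

text \<open>By \<open>paley_wiener_pointwise_bound\<close> a sequence that is Cauchy in norm converges locally uniformly, so its
  limit is entire, with a type bound inherited from the pointwise estimate. Fatou's lemma turns the
  Cauchy condition into convergence in norm.\<close>

theorem paley_wiener_complete:
  assumes u: "\<And>n. u n \<in> paley_wiener \<sigma>" and "\<sigma> > 0"
    and Cauchy: "\<And>e. e > 0 \<Longrightarrow> \<exists>M. \<forall>m\<ge>M. \<forall>n\<ge>M. pw_norm (u m - u n) < e"
  obtains f where "f \<in> paley_wiener \<sigma>" "(\<lambda>n. pw_norm (u n - f)) \<longlonglongrightarrow> 0"
proof -
  obtain A where A: "A > 0"
    "\<And>f w. f \<in> paley_wiener \<sigma> \<Longrightarrow> cmod (f w) \<le> A * exp (\<sigma> * \<bar>Im w\<bar>) * pw_norm f"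
    using paley_wiener_pointwise_bound[OF \<open>\<sigma> > 0\<close>] by blast
  have diff: "cmod (u m z - u n z) \<le> A * exp (\<sigma> * \<bar>Im z\<bar>) * pw_norm (u m - u n)" for m n z
    using A(2)[OF paley_wiener_diff[OF u u], of m n z] by simp
  have "Cauchy (\<lambda>n. u n z)" for z
  proof (rule metric_CauchyI)
    fix e :: real assume "e > 0"
    define c where "c = A * exp (\<sigma> * \<bar>Im z\<bar>)"
    have "c > 0" using A(1) by (simp add: c_def)
    obtain M where M: "\<forall>m\<ge>M. \<forall>n\<ge>M. pw_norm (u m - u n) < e / c"
      using Cauchy[of "e / c"] \<open>e > 0\<close> \<open>c > 0\<close> by auto
    have "dist (u m z) (u n z) < e" if "m \<ge> M" "n \<ge> M" for m n
    proof -
      have "c * pw_norm (u m - u n) < c * (e / c)"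
        using M that \<open>c > 0\<close> by (intro mult_strict_left_mono) auto
      moreover have "c * (e / c) = e" using \<open>c > 0\<close> by simp
      ultimately show ?thesis using diff[of m z n] unfolding dist_norm c_def by linarith
    qed
    then show "\<exists>M. \<forall>m\<ge>M. \<forall>n\<ge>M. dist (u m z) (u n z) < e" by blast
  qed
  then have "\<exists>l. (\<lambda>n. u n z) \<longlonglongrightarrow> l" for z by (simp add: Cauchy_convergent_iff convergent_def)
  then obtain f where lim: "\<And>z. (\<lambda>n. u n z) \<longlonglongrightarrow> f z" by metis
  have limit_bound: "cmod (u n z - f z) \<le> A * exp (\<sigma> * \<bar>Im z\<bar>) * e"
    if M: "\<forall>m\<ge>M. \<forall>n\<ge>M. pw_norm (u m - u n) < e" and "n \<ge> M" for M e n z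
  proof (rule tendsto_upperbound)
    show "(\<lambda>m. cmod (u n z - u m z)) \<longlonglongrightarrow> cmod (u n z - f z)" by (intro tendsto_intros lim)
    show "\<forall>\<^sub>F m in sequentially. cmod (u n z - u m z) \<le> A * exp (\<sigma> * \<bar>Im z\<bar>) * e"
      using eventually_ge_at_top[of M]
    proof eventually_elim
      case (elim m)
      have "A * exp (\<sigma> * \<bar>Im z\<bar>) * pw_norm (u n - u m) \<le> A * exp (\<sigma> * \<bar>Im z\<bar>) * e"
        using M elim \<open>n \<ge> M\<close> A(1) by (intro mult_left_mono) (auto intro: less_imp_le)
      then show ?case using diff[of n z m] by linarith
    qed
  qed simp
  have hol: "f holomorphic_on UNIV"
  proof (rule holomorphic_uniform_sequence[OF open_UNIV])
    show "u n holomorphic_on UNIV" for n using paley_wienerD(1)[OF u] .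
    fix x :: complex
    have "uniform_limit (cball x 1) u f sequentially"
    proof (rule uniform_limitI)
      fix e :: real assume "e > 0"
      define c where "c = A * exp (\<sigma> * (cmod x + 1))"
      have "c > 0" using A(1) by (simp add: c_def)
      obtain M where M: "\<forall>m\<ge>M. \<forall>n\<ge>M. pw_norm (u m - u n) < e / (2 * c)"
        using Cauchy[of "e / (2 * c)"] \<open>e > 0\<close> \<open>c > 0\<close> by auto
      show "\<forall>\<^sub>F n in sequentially. \<forall>z\<in>cball x 1. dist (u n z) (f z) < e"
        using eventually_ge_at_top[of M]
      proof (eventually_elim, intro ballI)
        fix n z assume "M \<le> n" "z \<in> cball x 1"
        then have "cmod z \<le> cmod x + 1" using norm_triangle_ineq2[of z x] by (simp add: dist_norm norm_minus_commute)
        then have "\<bar>Im z\<bar> \<le> cmod x + 1" using abs_Im_le_cmod[of z] by linarith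
        then have "A * exp (\<sigma> * \<bar>Im z\<bar>) \<le> c" using \<open>\<sigma> > 0\<close> A(1) by (simp add: c_def)
        then have "A * exp (\<sigma> * \<bar>Im z\<bar>) * (e / (2 * c)) \<le> c * (e / (2 * c))"
          using \<open>e > 0\<close> \<open>c > 0\<close> by (intro mult_right_mono) auto
        also have "\<dots> < e" using \<open>e > 0\<close> \<open>c > 0\<close> by simp
        finally show "dist (u n z) (f z) < e"
          using limit_bound[OF M \<open>M \<le> n\<close>, of z] by (simp add: dist_norm)
      qed
    qed
    then show "\<exists>d>0. cball x d \<subseteq> UNIV \<and> uniform_limit (cball x d) u f sequentially"
      by (intro exI[of _ 1]) auto
  qed
  have contr: "(\<lambda>t::real. f (of_real t)) \<in> borel_measurable borel"
    by (intro borel_measurable_continuous_onI continuous_on_compose2[OF holomorphic_on_imp_continuous_on[OF hol]])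
      (auto intro!: continuous_intros)
  have Fatou: "(\<integral>\<^sup>+t. ennreal ((cmod (u n (of_real t) - f (of_real t)))\<^sup>2) \<partial>lborel) \<le> ennreal (e\<^sup>2)"
    if M: "\<forall>m\<ge>M. \<forall>n\<ge>M. pw_norm (u m - u n) < e" and "n \<ge> M" for M e n
  proof -
    have meas: "(\<lambda>t. ennreal ((cmod (u n (of_real t) - u m (of_real t)))\<^sup>2)) \<in> borel_measurable lborel" for m
      using paley_wiener_measurable[OF u] by measurable
    have "(\<integral>\<^sup>+t. ennreal ((cmod (u n (of_real t) - f (of_real t)))\<^sup>2) \<partial>lborel)
        = (\<integral>\<^sup>+t. liminf (\<lambda>m. ennreal ((cmod (u n (of_real t) - u m (of_real t)))\<^sup>2)) \<partial>lborel)"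
    proof (rule nn_integral_cong)
      fix t
      have "(\<lambda>m. ennreal ((cmod (u n (of_real t) - u m (of_real t)))\<^sup>2))
          \<longlonglongrightarrow> ennreal ((cmod (u n (of_real t) - f (of_real t)))\<^sup>2)"
        by (intro tendsto_intros tendsto_ennrealI lim)
      then show "ennreal ((cmod (u n (of_real t) - f (of_real t)))\<^sup>2)
          = liminf (\<lambda>m. ennreal ((cmod (u n (of_real t) - u m (of_real t)))\<^sup>2))"
        by (rule lim_imp_Liminf[OF sequentially_bot, symmetric])
    qed
    also have "\<dots> \<le> liminf (\<lambda>m. \<integral>\<^sup>+t. ennreal ((cmod (u n (of_real t) - u m (of_real t)))\<^sup>2) \<partial>lborel)"
      by (rule nn_integral_liminf[OF meas])
    also have "\<dots> \<le> liminf (\<lambda>m::nat. ennreal (e\<^sup>2))"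
    proof (rule Liminf_mono)
      show "\<forall>\<^sub>F m in sequentially. (\<integral>\<^sup>+t. ennreal ((cmod (u n (of_real t) - u m (of_real t)))\<^sup>2) \<partial>lborel) \<le> ennreal (e\<^sup>2)"
        using eventually_ge_at_top[of M]
      proof eventually_elim
        case (elim m)
        have "(pw_norm (u n - u m))\<^sup>2 \<le> e\<^sup>2"
          using M elim \<open>n \<ge> M\<close> by (intro power_mono pw_norm_nonneg) (auto intro: less_imp_le)
        then show ?case
          using nn_integral_pw_norm[OF paley_wiener_diff[OF u u], of n m] by (simp add: ennreal_leI)
      qed
    qed
    also have "\<dots> = ennreal (e\<^sup>2)" by (simp add: Liminf_const)
    finally show ?thesis .
  qed
  have close: "u n - f \<in> paley_wiener \<sigma> \<and> pw_norm (u n - f) \<le> e"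
    if M: "\<forall>m\<ge>M. \<forall>n\<ge>M. pw_norm (u m - u n) < e" and "n \<ge> M" "e > 0" for M e n
  proof -
    have meas: "(\<lambda>t::real. u n (of_real t) - f (of_real t)) \<in> borel_measurable lborel"
      using paley_wiener_measurable[OF u] contr by measurable
    have int: "integrable lborel (\<lambda>t::real. (cmod ((u n - f) (of_real t)))\<^sup>2)"
    proof (rule integrableI_bounded)
      show "(\<lambda>t::real. (cmod ((u n - f) (of_real t)))\<^sup>2) \<in> borel_measurable lborel"
        unfolding minus_apply using meas by measurable
      show "(\<integral>\<^sup>+t. ennreal (norm ((cmod ((u n - f) (of_real t)))\<^sup>2)) \<partial>lborel) < \<infinity>"
        using order_le_less_trans[OF Fatou[OF M \<open>n \<ge> M\<close>]] by simp
    qed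
    have "exp_type_le \<sigma> (u n - f)"
      unfolding exp_type_le_def
    proof (intro allI impI exI)
      fix \<epsilon> :: real and z assume "\<epsilon> > 0"
      have "A * exp (\<sigma> * \<bar>Im z\<bar>) * e \<le> A * exp ((\<sigma> + \<epsilon>) * cmod z) * e"
      proof -
        have "\<sigma> * \<bar>Im z\<bar> \<le> (\<sigma> + \<epsilon>) * cmod z"
          using \<open>\<sigma> > 0\<close> \<open>\<epsilon> > 0\<close> abs_Im_le_cmod[of z] by (intro mult_mono) auto
        then show ?thesis using A(1) \<open>e > 0\<close> by simp
      qed
      with limit_bound[OF M \<open>n \<ge> M\<close>, of z]
      show "cmod ((u n - f) z) \<le> (A * e) * exp ((\<sigma> + \<epsilon>) * cmod z)" by (simp add: mult_ac)
    qed
    moreover have "u n - f holomorphic_on UNIV"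
      unfolding fun_diff_def by (intro holomorphic_intros hol paley_wienerD(1)[OF u])
    ultimately have pw: "u n - f \<in> paley_wiener \<sigma>" using int by (simp add: paley_wiener_def)
    have "ennreal ((pw_norm (u n - f))\<^sup>2) \<le> ennreal (e\<^sup>2)"
      using nn_integral_pw_norm[OF pw] Fatou[OF M \<open>n \<ge> M\<close>] by simp
    then have "(pw_norm (u n - f))\<^sup>2 \<le> e\<^sup>2" by (simp add: ennreal_le_iff)
    then have "pw_norm (u n - f) \<le> e" using \<open>e > 0\<close> by (rule power2_le_imp_le[OF _ less_imp_le])
    with pw show ?thesis by blast
  qed
  obtain M where M: "\<forall>m\<ge>M. \<forall>n\<ge>M. pw_norm (u m - u n) < 1" using Cauchy[of 1] by auto
  have "u M - f \<in> paley_wiener \<sigma>" using close[OF M order_refl zero_less_one] by (rule conjunct1)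
  from paley_wiener_diff[OF u[of M] this] have "f \<in> paley_wiener \<sigma>" by (simp add: fun_diff_def)
  moreover have "(\<lambda>n. pw_norm (u n - f)) \<longlonglongrightarrow> 0"
  proof (rule LIMSEQ_I)
    fix e :: real assume "e > 0"
    obtain M where M: "\<forall>m\<ge>M. \<forall>n\<ge>M. pw_norm (u m - u n) < e / 2" using Cauchy[of "e / 2"] \<open>e > 0\<close> by auto
    have "norm (pw_norm (u n - f) - 0) < e" if "n \<ge> M" for n
    proof -
      have "pw_norm (u n - f) \<le> e / 2" using close[OF M that] \<open>e > 0\<close> by simp
      then show ?thesis using \<open>e > 0\<close> pw_norm_nonneg[of "u n - f"] by simp
    qed
    then show "\<exists>N. \<forall>n\<ge>N. norm (pw_norm (u n - f) - 0) < e" by blast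
  qed
  ultimately show ?thesis by (rule that)
qed

section \<open>Translations, dilations and the composition operator\<close>

text \<open>Young's inequality for the convolution of an \<open>L\<^sup>2\<close> function \<open>u\<close> with an \<open>L\<^sup>1\<close> function, the latter given as
  a square \<open>q\<^sup>2\<close> so that the Cauchy-Schwarz inequality can be applied to \<open>(u q) q\<close>.\<close>

lemma nn_integral_convolution_square_le:
  fixes u q :: "real \<Rightarrow> real"
  assumes [measurable]: "u \<in> borel_measurable borel" "q \<in> borel_measurable borel"
    and u: "\<And>s. u s \<ge> 0" and q: "\<And>x. q x \<ge> 0"
  shows "(\<integral>\<^sup>+t. (\<integral>\<^sup>+s. ennreal (u s * (q (s - t))\<^sup>2) \<partial>lborel)\<^sup>2 \<partial>lborel)
    \<le> (\<integral>\<^sup>+x. ennreal ((q x)\<^sup>2) \<partial>lborel)\<^sup>2 * (\<integral>\<^sup>+s. ennreal ((u s)\<^sup>2) \<partial>lborel)"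
proof -
  define P where "P = (\<integral>\<^sup>+x. ennreal ((q x)\<^sup>2) \<partial>lborel)"
  have P_shift: "(\<integral>\<^sup>+s. ennreal ((q (s - t))\<^sup>2) \<partial>lborel) = P" for t
    unfolding P_def using nn_integral_real_affine[of "\<lambda>x. ennreal ((q x)\<^sup>2)" 1 "- t"] by simp
  have P_reflect: "(\<integral>\<^sup>+t. ennreal ((q (s - t))\<^sup>2) \<partial>lborel) = P" for s
    unfolding P_def using nn_integral_real_affine[of "\<lambda>x. ennreal ((q x)\<^sup>2)" "- 1" s] by simp
  have inner: "(\<integral>\<^sup>+s. ennreal (u s * (q (s - t))\<^sup>2) \<partial>lborel)\<^sup>2
      \<le> (\<integral>\<^sup>+s. ennreal ((u s)\<^sup>2) * ennreal ((q (s - t))\<^sup>2) \<partial>lborel) * P" for t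
  proof -
    have "(\<integral>\<^sup>+s. ennreal (u s * (q (s - t))\<^sup>2) \<partial>lborel)
        = (\<integral>\<^sup>+s. ennreal (u s * q (s - t)) * ennreal (q (s - t)) \<partial>lborel)"
      using u q by (simp add: ennreal_mult'[symmetric] power2_eq_square mult.assoc)
    also have "\<dots>\<^sup>2 \<le> (\<integral>\<^sup>+s. (ennreal (u s * q (s - t)))\<^sup>2 \<partial>lborel) * (\<integral>\<^sup>+s. (ennreal (q (s - t)))\<^sup>2 \<partial>lborel)"
      by (rule Cauchy_Schwarz_nn_integral) measurable
    also have "\<dots> = (\<integral>\<^sup>+s. ennreal ((u s)\<^sup>2) * ennreal ((q (s - t))\<^sup>2) \<partial>lborel) * P"
      unfolding P_shift[of t, symmetric]
      using u q by (simp add: ennreal_power power_mult_distrib ennreal_mult')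
    finally show ?thesis .
  qed
  have "(\<integral>\<^sup>+t. (\<integral>\<^sup>+s. ennreal (u s * (q (s - t))\<^sup>2) \<partial>lborel)\<^sup>2 \<partial>lborel)
      \<le> (\<integral>\<^sup>+t. (\<integral>\<^sup>+s. ennreal ((u s)\<^sup>2) * ennreal ((q (s - t))\<^sup>2) \<partial>lborel) * P \<partial>lborel)"
    by (intro nn_integral_mono inner)
  also have "\<dots> = (\<integral>\<^sup>+t. (\<integral>\<^sup>+s. ennreal ((u s)\<^sup>2) * ennreal ((q (s - t))\<^sup>2) \<partial>lborel) \<partial>lborel) * P"
    by (rule nn_integral_multc) measurable
  also have "(\<integral>\<^sup>+t. (\<integral>\<^sup>+s. ennreal ((u s)\<^sup>2) * ennreal ((q (s - t))\<^sup>2) \<partial>lborel) \<partial>lborel)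
      = (\<integral>\<^sup>+s. (\<integral>\<^sup>+t. ennreal ((u s)\<^sup>2) * ennreal ((q (s - t))\<^sup>2) \<partial>lborel) \<partial>lborel)"
    by (rule lborel_pair.Fubini') measurable
  also have "\<dots> = (\<integral>\<^sup>+s. ennreal ((u s)\<^sup>2) * P \<partial>lborel)"
    by (intro nn_integral_cong) (simp add: nn_integral_cmult P_reflect)
  also have "\<dots> = (\<integral>\<^sup>+s. ennreal ((u s)\<^sup>2) \<partial>lborel) * P"
    by (rule nn_integral_multc) measurable
  finally show ?thesis unfolding P_def[symmetric] by (simp add: power2_eq_square mult_ac)
qed

lemma reg_kernel_quadratic_decay:
  assumes "\<sigma> > 0"
  obtains B where "B \<ge> 0" "\<And>x::real. cmod (reg_kernel \<sigma> 1 (of_real x - b)) * (1 + x\<^sup>2) \<le> B"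
proof -
  obtain C1 where C1: "C1 > 0" "\<And>\<kappa> z. \<kappa> \<ge> 1 \<Longrightarrow> cmod (csinc (of_real \<kappa> * (z - b))) * (1 + cmod z)
      \<le> C1 * exp (\<kappa> * \<bar>Im b\<bar>) * exp (\<kappa> * \<bar>Im z\<bar>)"
    using csinc_shift_bound[OF zero_less_one] by metis
  define A1 where "A1 = C1 * exp \<bar>Im b\<bar>"
  define A2 where "A2 = C1 * exp ((\<sigma> + 3) * \<bar>Im b\<bar>)"
  have "cmod (reg_kernel \<sigma> 1 (of_real x - b)) * (1 + x\<^sup>2) \<le> (\<sigma> + 3) / pi * (A1 * (A1 * A2))" for x :: real
  proof -
    let ?c1 = "cmod (csinc (of_real 1 * (of_real x - b)))"
    let ?c2 = "cmod (csinc (of_real (\<sigma> + 3) * (of_real x - b)))"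
    have 1: "?c1 * (1 + \<bar>x\<bar>) \<le> A1" using C1(2)[of 1 "of_real x"] by (simp add: A1_def)
    have 2: "?c2 * (1 + \<bar>x\<bar>) \<le> A2" using C1(2)[of "\<sigma> + 3" "of_real x"] assms by (simp add: A2_def)
    have "?c1 * 1 \<le> ?c1 * (1 + \<bar>x\<bar>)" by (intro mult_left_mono) auto
    with 1 have 3: "?c1 \<le> A1" by simp
    have kernel: "cmod (reg_kernel \<sigma> 1 (of_real x - b)) = (\<sigma> + 3) / pi * (?c1\<^sup>2 * ?c2)"
    proof -
      have "cmod (of_real ((\<sigma> + 3) / pi)) = (\<sigma> + 3) / pi" unfolding norm_of_real using assms by simp
      then show ?thesis by (simp only: reg_kernel_def norm_mult norm_power mult_1_right mult.assoc)
    qed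
    have "1 + x\<^sup>2 \<le> (1 + \<bar>x\<bar>) * (1 + \<bar>x\<bar>)" by (simp add: power2_eq_square algebra_simps)
    then have "cmod (reg_kernel \<sigma> 1 (of_real x - b)) * (1 + x\<^sup>2)
        \<le> (\<sigma> + 3) / pi * (?c1\<^sup>2 * ?c2) * ((1 + \<bar>x\<bar>) * (1 + \<bar>x\<bar>))"
      unfolding kernel using assms by (intro mult_left_mono) simp_all
    also have "\<dots> = (\<sigma> + 3) / pi * (?c1 * ((?c1 * (1 + \<bar>x\<bar>)) * (?c2 * (1 + \<bar>x\<bar>))))"
      by (simp add: power2_eq_square)
    also have "\<dots> \<le> (\<sigma> + 3) / pi * (A1 * (A1 * A2))"
      using assms C1(1) by (intro mult_left_mono mult_mono 1 2 3) (auto simp: A1_def A2_def)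
    finally show ?thesis .
  qed
  then show ?thesis using assms C1(1)
    by (intro that[of "(\<sigma> + 3) / pi * (A1 * (A1 * A2))"]) (auto simp: A1_def A2_def)
qed

text \<open>For real \<open>b\<close> the square-integrability is translation invariance. For complex \<open>b\<close> it says that \<open>f\<close> is
  square-integrable on a horizontal line: the mollified reproducing formula writes \<open>f (t + b)\<close> as a
  convolution of \<open>f\<close> on the real line with an integrable kernel, and Young's inequality applies. The sharp
  kernel would not do, since \<open>sin t / t\<close> is not integrable.\<close>

lemma paley_wiener_shift:
  assumes f: "f \<in> paley_wiener \<sigma>" and "\<sigma> > 0"
  shows "(\<lambda>z. f (z + b)) \<in> paley_wiener \<sigma>"
proof -
  have hol: "(\<lambda>z. f (z + b)) holomorphic_on UNIV"
    using holomorphic_on_compose[OF holomorphic_on_add[OF holomorphic_on_ident holomorphic_on_const]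
        holomorphic_on_subset[OF paley_wienerD(1)[OF f]]] by (simp add: o_def)
  have "exp_type_le \<sigma> (\<lambda>z. f (z + b))"
    unfolding exp_type_le_def
  proof (intro allI impI)
    fix \<epsilon> :: real assume "\<epsilon> > 0"
    obtain C where C: "C \<ge> 0" "\<And>z. cmod (f z) \<le> C * exp ((\<sigma> + \<epsilon>) * cmod z)"
      using exp_type_leE[OF paley_wienerD(3)[OF f] \<open>\<epsilon> > 0\<close>] by blast
    have "cmod (f (z + b)) \<le> (C * exp ((\<sigma> + \<epsilon>) * cmod b)) * exp ((\<sigma> + \<epsilon>) * cmod z)" for z
    proof -
      have "(\<sigma> + \<epsilon>) * cmod (z + b) \<le> (\<sigma> + \<epsilon>) * (cmod b + cmod z)"
        using \<open>\<sigma> > 0\<close> \<open>\<epsilon> > 0\<close> norm_triangle_ineq[of z b] by (intro mult_left_mono) auto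
      then have "C * exp ((\<sigma> + \<epsilon>) * cmod (z + b)) \<le> C * exp ((\<sigma> + \<epsilon>) * (cmod b + cmod z))"
        using C(1) by (intro mult_left_mono) auto
      also have "\<dots> = (C * exp ((\<sigma> + \<epsilon>) * cmod b)) * exp ((\<sigma> + \<epsilon>) * cmod z)"
        by (simp add: distrib_left exp_add)
      finally show ?thesis using C(2)[of "z + b"] by linarith
    qed
    then show "\<exists>C. \<forall>z. cmod (f (z + b)) \<le> C * exp ((\<sigma> + \<epsilon>) * cmod z)" by blast
  qed
  moreover have "integrable lborel (\<lambda>t::real. (cmod (f (of_real t + b)))\<^sup>2)"
  proof (rule integrableI_bounded)
    have "(\<lambda>t::real. f (of_real t + b)) \<in> borel_measurable borel"
      by (intro borel_measurable_continuous_onI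
          continuous_on_compose2[OF holomorphic_on_imp_continuous_on[OF paley_wienerD(1)[OF f]]])
        (auto intro!: continuous_intros)
    then show "(\<lambda>t::real. (cmod (f (of_real t + b)))\<^sup>2) \<in> borel_measurable lborel" by measurable
    obtain B where B: "B \<ge> 0" "\<And>x::real. cmod (reg_kernel \<sigma> 1 (of_real x - b)) * (1 + x\<^sup>2) \<le> B"
      using reg_kernel_quadratic_decay[OF \<open>\<sigma> > 0\<close>] by blast
    define u where "u s = B * cmod (f (of_real s))" for s :: real
    define q where "q x = 1 / sqrt (1 + x\<^sup>2)" for x :: real
    have q2: "(q x)\<^sup>2 = 1 / (1 + x\<^sup>2)" for x
      by (simp add: q_def power_divide add_nonneg_nonneg)
    have u_meas: "u \<in> borel_measurable borel"
      unfolding u_def using paley_wiener_measurable[OF f] by simp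
    have q_meas: "q \<in> borel_measurable borel" unfolding q_def by measurable
    have pointwise: "ennreal (cmod (f (of_real t + b))) \<le> (\<integral>\<^sup>+s. ennreal (u s * (q (s - t))\<^sup>2) \<partial>lborel)" for t :: real
    proof -
      note rep = paley_wiener_regularized_representation[OF f \<open>\<sigma> > 0\<close> zero_less_one, of "of_real t + b"]
      have "ennreal (cmod (f (of_real t + b)))
          \<le> (\<integral>\<^sup>+s. ennreal (norm (f (of_real s) * reg_kernel \<sigma> 1 (of_real s - (of_real t + b)))) \<partial>lborel)"
        unfolding rep(2) by (rule integral_norm_bound_ennreal[OF rep(1)])
      also have "\<dots> \<le> (\<integral>\<^sup>+s. ennreal (u s * (q (s - t))\<^sup>2) \<partial>lborel)"
      proof (intro nn_integral_mono ennreal_leI)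
        fix s :: real
        have "cmod (reg_kernel \<sigma> 1 (of_real (s - t) - b)) \<le> B / (1 + (s - t)\<^sup>2)"
          using B(2)[of "s - t"] by (subst pos_le_divide_eq) (auto intro: add_pos_nonneg)
        then have "cmod (f (of_real s)) * cmod (reg_kernel \<sigma> 1 (of_real (s - t) - b))
            \<le> cmod (f (of_real s)) * (B / (1 + (s - t)\<^sup>2))"
          by (intro mult_left_mono) auto
        then show "norm (f (of_real s) * reg_kernel \<sigma> 1 (of_real s - (of_real t + b))) \<le> u s * (q (s - t))\<^sup>2"
          unfolding norm_mult u_def q2 by (simp add: diff_diff_eq mult_ac)
      qed
      finally show ?thesis .
    qed
    have "(\<integral>\<^sup>+t. ennreal (norm ((cmod (f (of_real t + b)))\<^sup>2)) \<partial>lborel)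
        = (\<integral>\<^sup>+t. (ennreal (cmod (f (of_real t + b))))\<^sup>2 \<partial>lborel)"
      by (simp add: ennreal_power)
    also have "\<dots> \<le> (\<integral>\<^sup>+t. (\<integral>\<^sup>+s. ennreal (u s * (q (s - t))\<^sup>2) \<partial>lborel)\<^sup>2 \<partial>lborel)"
      by (intro nn_integral_mono power_mono pointwise) simp
    also have "\<dots> \<le> (\<integral>\<^sup>+x. ennreal ((q x)\<^sup>2) \<partial>lborel)\<^sup>2 * (\<integral>\<^sup>+s. ennreal ((u s)\<^sup>2) \<partial>lborel)"
      using B(1) by (intro nn_integral_convolution_square_le u_meas q_meas) (auto simp: u_def q_def)
    also have "\<dots> < \<infinity>"
    proof -
      have "(\<integral>\<^sup>+x. ennreal ((q x)\<^sup>2) \<partial>lborel) = ennreal (LINT x|lborel. 1 / (1 + x\<^sup>2))"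
        unfolding q2 by (rule nn_integral_eq_integral[OF integrable_inverse_one_plus_square]) auto
      moreover have "(\<integral>\<^sup>+s. ennreal ((u s)\<^sup>2) \<partial>lborel) = ennreal (LINT s|lborel. B\<^sup>2 * (cmod (f (of_real (s::real))))\<^sup>2)"
        unfolding u_def power_mult_distrib
        using paley_wienerD(4)[OF f] by (intro nn_integral_eq_integral) auto
      ultimately show ?thesis by (simp add: ennreal_power ennreal_mult_less_top)
    qed
    finally show "(\<integral>\<^sup>+t. ennreal (norm ((cmod (f (of_real t + b)))\<^sup>2)) \<partial>lborel) < \<infinity>" .
  qed
  ultimately show ?thesis using hol by (simp add: paley_wiener_def)
qed

lemma paley_wiener_dilation:
  assumes f: "f \<in> paley_wiener \<sigma>" and "a \<noteq> 0"
  shows "(\<lambda>z. f (of_real a * z)) \<in> paley_wiener (\<bar>a\<bar> * \<sigma>)"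
proof -
  have "(\<lambda>z. f (of_real a * z)) holomorphic_on UNIV"
    using holomorphic_on_compose[OF holomorphic_on_mult[OF holomorphic_on_const holomorphic_on_ident]
        holomorphic_on_subset[OF paley_wienerD(1)[OF f]]] by (simp add: o_def)
  moreover have "exp_type_le (\<bar>a\<bar> * \<sigma>) (\<lambda>z. f (of_real a * z))"
    unfolding exp_type_le_def
  proof (intro allI impI)
    fix \<epsilon> :: real assume "\<epsilon> > 0"
    then have "\<epsilon> / \<bar>a\<bar> > 0" using \<open>a \<noteq> 0\<close> by simp
    then obtain C where C: "\<And>z. cmod (f z) \<le> C * exp ((\<sigma> + \<epsilon> / \<bar>a\<bar>) * cmod z)"
      using paley_wienerD(3)[OF f] unfolding exp_type_le_def by blast
    have "(\<sigma> + \<epsilon> / \<bar>a\<bar>) * cmod (of_real a * z) = (\<bar>a\<bar> * \<sigma> + \<epsilon>) * cmod z" for z :: complex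
      using \<open>a \<noteq> 0\<close> by (simp add: norm_mult field_simps)
    then show "\<exists>C. \<forall>z. cmod (f (of_real a * z)) \<le> C * exp ((\<bar>a\<bar> * \<sigma> + \<epsilon>) * cmod z)"
      using C[of "of_real a * z" for z] by metis
  qed
  moreover have "integrable lborel (\<lambda>t::real. (cmod (f (of_real a * of_real t)))\<^sup>2)"
    using lborel_integrable_real_affine[OF paley_wienerD(4)[OF f] \<open>a \<noteq> 0\<close>, of 0] by simp
  ultimately show ?thesis by (simp add: paley_wiener_def)
qed

text \<open>The translation preserves the type and the dilation multiplies it by \<open>\<bar>a\<bar>\<close>; this drop is what prevents
  cyclicity for \<open>\<bar>a\<bar> < 1\<close>.\<close>

lemma comp_op_affine_in_paley_wiener:
  assumes "f \<in> paley_wiener \<sigma>" and "\<sigma> > 0" "a \<noteq> 0"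
  shows "comp_op (\<lambda>z. of_real a * z + b) f \<in> paley_wiener (\<bar>a\<bar> * \<sigma>)"
  using paley_wiener_dilation[OF paley_wiener_shift[OF assms(1,2)] \<open>a \<noteq> 0\<close>]
  by (simp add: comp_op_def o_def)

section \<open>The composition operator is not cyclic\<close>

text \<open>Both kernels reproduce the value at \<open>w\<close> of a function of the smaller type.\<close>

lemma pw_kernel_diff_orthogonal:
  assumes h: "h \<in> paley_wiener \<tau>" and "0 < \<tau>" "\<tau> \<le> \<sigma>"
  shows "pw_inner h (pw_kernel \<sigma> w - pw_kernel \<tau> w) = 0"
proof -
  have "\<sigma> > 0" using assms by simp
  have h': "h \<in> paley_wiener \<sigma>" by (rule paley_wiener_mono[OF h \<open>\<tau> \<le> \<sigma>\<close>])
  have "pw_kernel \<tau> w \<in> paley_wiener \<sigma>"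
    by (rule paley_wiener_mono[OF pw_kernel_in_paley_wiener[OF \<open>0 < \<tau>\<close>] \<open>\<tau> \<le> \<sigma>\<close>])
  then have "pw_inner h (pw_kernel \<sigma> w - pw_kernel \<tau> w) = h w - h w"
    using pw_inner_diff_right[OF pw_kernel_in_paley_wiener[OF \<open>\<sigma> > 0\<close>] _ h']
      paley_wiener_reproducing[OF h' \<open>\<sigma> > 0\<close>] paley_wiener_reproducing[OF h \<open>0 < \<tau>\<close>] by simp
  then show ?thesis by simp
qed

text \<open>Two linearly independent vectors orthogonal to the smaller space leave room for one more condition,
  orthogonality to \<open>f\<close>. The points \<open>0\<close> and \<open>w = 2 \<pi> / (\<sigma> - \<tau>)\<close> are chosen such that \<open>\<sigma> w\<close> and \<open>\<tau> w\<close> differ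
  by a full period: the kernel difference at one of them then vanishes at the other but not at itself,
  which makes independence evident.\<close>

lemma exists_orthogonal_to_smaller_type:
  assumes f: "f \<in> paley_wiener \<sigma>" and "0 < \<tau>" "\<tau> < \<sigma>"
  obtains g where "g \<in> paley_wiener \<sigma>" "g \<noteq> 0" "pw_inner f g = 0"
    "\<And>h. h \<in> paley_wiener \<tau> \<Longrightarrow> pw_inner h g = 0"
proof -
  define w where "w = complex_of_real (2 * pi / (\<sigma> - \<tau>))"
  have "\<sigma> > 0" using assms by simp
  have "w \<noteq> 0" "cnj w = w" using assms by (simp_all add: w_def)
  define k where "k v = pw_kernel \<sigma> v - pw_kernel \<tau> v" for v
  have k_in: "k v \<in> paley_wiener \<sigma>" for v
    unfolding k_def
    using pw_kernel_in_paley_wiener[OF \<open>\<sigma> > 0\<close>]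
      paley_wiener_mono[OF pw_kernel_in_paley_wiener[OF \<open>0 < \<tau>\<close>] less_imp_le[OF \<open>\<tau> < \<sigma>\<close>]]
    by (rule paley_wiener_diff)
  have k_orth: "pw_inner h (k v) = 0" if "h \<in> paley_wiener \<tau>" for h v
    unfolding k_def using pw_kernel_diff_orthogonal[OF that] assms by simp
  have k_diag: "k 0 0 \<noteq> 0" "k w w \<noteq> 0"
    using assms \<open>cnj w = w\<close> by (simp_all add: k_def pw_kernel_def csinc_def)
  have sin_eq: "sin (of_real \<sigma> * w) = sin (of_real \<tau> * w)"
  proof -
    have "\<sigma> * (2 * pi / (\<sigma> - \<tau>)) = \<tau> * (2 * pi / (\<sigma> - \<tau>)) + 2 * pi"
      using assms by (simp add: field_simps)
    then have "sin (\<sigma> * (2 * pi / (\<sigma> - \<tau>))) = sin (\<tau> * (2 * pi / (\<sigma> - \<tau>)))"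
      using sin_periodic by simp
    then show ?thesis unfolding w_def of_real_mult[symmetric] sin_of_real by simp
  qed
  have "of_real (\<sigma> / pi) * csinc (of_real \<sigma> * w) = of_real (\<tau> / pi) * csinc (of_real \<tau> * w)"
    using assms \<open>w \<noteq> 0\<close> sin_eq by (simp add: csinc_def)
  then have "k w 0 = 0"
    using \<open>cnj w = w\<close> by (simp add: k_def pw_kernel_def)
  show ?thesis
  proof (cases "pw_inner f (k w) = 0")
    case True
    have "k w \<noteq> 0" using k_diag(2) by auto
    with True show ?thesis using that[of "k w"] k_in k_orth by blast
  next
    case False
    \<comment> \<open>The combination of \<open>k 0\<close> and \<open>k w\<close> for which the two contributions to \<open>\<langle>f, g\<rangle>\<close> cancel.\<close>
    define g where "g = scaleF (- cnj (pw_inner f (k w))) (k 0) + scaleF (cnj (pw_inner f (k 0))) (k w)"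
    have g_in: "g \<in> paley_wiener \<sigma>"
      unfolding g_def by (intro paley_wiener_add paley_wiener_scaleF k_in)
    have inner_g: "pw_inner h g = - pw_inner f (k w) * pw_inner h (k 0) + pw_inner f (k 0) * pw_inner h (k w)"
      if "h \<in> paley_wiener \<sigma>" for h
      unfolding g_def
      using pw_inner_add_right[OF paley_wiener_scaleF[OF k_in] paley_wiener_scaleF[OF k_in] that]
      by (simp add: pw_inner_scaleF_right del: cfun.scale_minus_left)
    have "g 0 = - cnj (pw_inner f (k w)) * k 0 0"
      using \<open>k w 0 = 0\<close> by (simp add: g_def scaleF_def)
    then have "g 0 \<noteq> 0" using False k_diag(1) by simp
    then have "g \<noteq> 0" by auto
    moreover have "pw_inner f g = 0" using inner_g[OF f] by simp
    moreover have "pw_inner h g = 0" if "h \<in> paley_wiener \<tau>" for h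
      using inner_g[OF paley_wiener_mono[OF that]] k_orth[OF that] assms by simp
    ultimately show ?thesis using that[of g] g_in by blast
  qed
qed

lemma pw_orthogonal_subspace:
  assumes "g \<in> paley_wiener \<sigma>"
  shows "cfun.subspace {h \<in> paley_wiener \<sigma>. pw_inner h g = 0}"
  unfolding cfun.subspace_def
  using assms by (auto simp: paley_wiener_zero paley_wiener_add paley_wiener_scaleF pw_inner_add_left
      pw_inner_scaleF_left) (simp add: pw_inner_def)

text \<open>All iterates from the first on lie in the space of smaller type, so one nonzero \<open>g\<close> is orthogonal to the
  whole span of the orbit and stays at distance \<open>\<parallel>g\<parallel>\<close> from it.\<close>

theorem comp_op_affine_not_cyclic:
  fixes a \<sigma> :: real
  assumes "0 < \<bar>a\<bar>" "\<bar>a\<bar> < 1" "\<sigma> > 0"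
  shows "\<not> pw_cyclic \<sigma> (comp_op (\<lambda>z. of_real a * z + b))"
proof
  let ?T = "comp_op (\<lambda>z. of_real a * z + b)"
  assume "pw_cyclic \<sigma> ?T"
  then obtain f where f: "f \<in> paley_wiener \<sigma>"
    and dense: "\<And>g \<epsilon>. g \<in> paley_wiener \<sigma> \<Longrightarrow> \<epsilon> > 0 \<Longrightarrow> \<exists>h\<in>cfun.span (range (\<lambda>n. (?T ^^ n) f)). pw_norm (g - h) < \<epsilon>"
    unfolding pw_cyclic_def by blast
  have \<tau>: "0 < \<bar>a\<bar> * \<sigma>" "\<bar>a\<bar> * \<sigma> < \<sigma>" using assms by simp_all
  obtain g where g: "g \<in> paley_wiener \<sigma>" "g \<noteq> 0" "pw_inner f g = 0"
    and orth: "\<And>h. h \<in> paley_wiener (\<bar>a\<bar> * \<sigma>) \<Longrightarrow> pw_inner h g = 0"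
    using exists_orthogonal_to_smaller_type[OF f \<tau>] by blast
  have small: "?T h \<in> paley_wiener (\<bar>a\<bar> * \<sigma>)" if "h \<in> paley_wiener \<sigma>" for h
    using comp_op_affine_in_paley_wiener[OF that] assms by simp
  have iter: "(?T ^^ n) f \<in> paley_wiener \<sigma>" for n
  proof (induction n)
    case (Suc n)
    then show ?case using paley_wiener_mono[OF small[OF Suc.IH] less_imp_le[OF \<tau>(2)]] by simp
  qed (use f in simp)
  have "pw_inner ((?T ^^ n) f) g = 0" for n
  proof (cases n)
    case (Suc m)
    then show ?thesis using orth[OF small[OF iter[of m]]] by simp
  qed (use g in simp)
  then have sub: "cfun.span (range (\<lambda>n. (?T ^^ n) f)) \<subseteq> {h \<in> paley_wiener \<sigma>. pw_inner h g = 0}"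
    using iter by (intro cfun.span_minimal pw_orthogonal_subspace g) auto
  have "pw_norm g > 0"
    using pw_norm_eq_0D[OF g(1) \<open>\<sigma> > 0\<close>] g(2) pw_norm_nonneg[of g] by force
  then obtain h where "h \<in> cfun.span (range (\<lambda>n. (?T ^^ n) f))" and lt: "pw_norm (g - h) < pw_norm g"
    using dense[OF g(1)] by blast
  with sub have h: "h \<in> paley_wiener \<sigma>" "pw_inner h g = 0" by auto
  have "(pw_norm g)\<^sup>2 \<le> (pw_norm (g - h))\<^sup>2"
    unfolding pw_norm_square_diff[OF g(1) h(1)] using pw_inner_commute[of g h] h(2) by simp
  with lt show False using pw_norm_nonneg[of "g - h"] by (simp add: power2_le_iff_abs_le)
qed

section \<open>The adjoint is cyclic\<close>

text \<open>The projection theorem. By the parallelogram law a minimizing sequence for the distance from \<open>g\<close> to the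
  span is Cauchy; completeness yields the residual \<open>f\<close>, which has minimal norm among its translates
  by the span and is therefore orthogonal to \<open>S\<close>. So \<open>f = 0\<close>, and the distance is zero.\<close>

theorem pw_dense_if_orthogonal_trivial:
  assumes S: "S \<subseteq> paley_wiener \<sigma>" and "\<sigma> > 0"
    and trivial: "\<And>f. f \<in> paley_wiener \<sigma> \<Longrightarrow> (\<And>s. s \<in> S \<Longrightarrow> pw_inner f s = 0) \<Longrightarrow> f = 0"
    and g: "g \<in> paley_wiener \<sigma>" and "\<epsilon> > 0"
  shows "\<exists>h\<in>cfun.span S. pw_norm (g - h) < \<epsilon>"
proof -
  let ?V = "cfun.span S"
  have V: "h \<in> paley_wiener \<sigma>" if "h \<in> ?V" for h
    using cfun.span_minimal[OF S paley_wiener_subspace] that by blast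
  define d where "d = (INF h\<in>?V. (pw_norm (g - h))\<^sup>2)"
  have d_le: "d \<le> (pw_norm (g - h))\<^sup>2" if "h \<in> ?V" for h
    unfolding d_def using that by (intro cINF_lower bdd_belowI[of _ 0]) auto
  have "\<exists>h\<in>?V. (pw_norm (g - h))\<^sup>2 < d + 1 / real (Suc n)" for n
  proof -
    have "(INF h\<in>?V. (pw_norm (g - h))\<^sup>2) < d + 1 / real (Suc n)" by (simp add: d_def)
    then show ?thesis using cfun.span_zero[of S]
      by (subst (asm) cINF_less_iff) (auto intro: bdd_belowI[of _ 0])
  qed
  then obtain H where H: "\<And>n. H n \<in> ?V" "\<And>n. (pw_norm (g - H n))\<^sup>2 < d + 1 / real (Suc n)" by metis
  define u where "u n = g - H n" for n
  have u: "u n \<in> paley_wiener \<sigma>" for n unfolding u_def by (intro paley_wiener_diff g V H)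
  have gap: "(pw_norm (u m - u n))\<^sup>2 \<le> 2 / real (Suc m) + 2 / real (Suc n)" for m n
  proof -
    have "scaleF (1/2) (H m + H n) \<in> ?V" by (intro cfun.span_scale cfun.span_add H)
    then have "d \<le> (pw_norm (g - scaleF (1/2) (H m + H n)))\<^sup>2" by (rule d_le)
    moreover have "u m + u n = scaleF 2 (g - scaleF (1/2) (H m + H n))"
      by (simp add: u_def scaleF_def fun_eq_iff field_simps)
    then have "(pw_norm (u m + u n))\<^sup>2 = 4 * (pw_norm (g - scaleF (1/2) (H m + H n)))\<^sup>2"
      by (simp add: pw_norm_scaleF power_mult_distrib)
    moreover have "(pw_norm (u m - u n))\<^sup>2 + (pw_norm (u m + u n))\<^sup>2 = 2 * (pw_norm (u m))\<^sup>2 + 2 * (pw_norm (u n))\<^sup>2"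
      unfolding pw_norm_square_diff[OF u u] pw_norm_square_add[OF u u] by simp
    moreover have "(pw_norm (u m))\<^sup>2 < d + 1 / real (Suc m)" "(pw_norm (u n))\<^sup>2 < d + 1 / real (Suc n)"
      unfolding u_def by (rule H)+
    ultimately show ?thesis by linarith
  qed
  have "\<exists>M. \<forall>m\<ge>M. \<forall>n\<ge>M. pw_norm (u m - u n) < e" if "e > 0" for e
  proof -
    obtain M where M: "1 / real (Suc M) < e\<^sup>2 / 4" using nat_approx_posE[of "e\<^sup>2 / 4"] \<open>e > 0\<close> by auto
    have "pw_norm (u m - u n) < e" if "m \<ge> M" "n \<ge> M" for m n
    proof (rule power2_less_imp_less)
      have "1 / real (Suc m) \<le> 1 / real (Suc M)" "1 / real (Suc n) \<le> 1 / real (Suc M)"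
        using that by (simp_all add: field_simps)
      then show "(pw_norm (u m - u n))\<^sup>2 < e\<^sup>2" using gap[of m n] M by linarith
    qed (use \<open>e > 0\<close> in simp)
    then show ?thesis by blast
  qed
  from paley_wiener_complete[OF u \<open>\<sigma> > 0\<close> this]
  obtain f where f: "f \<in> paley_wiener \<sigma>" and lim: "(\<lambda>n. pw_norm (u n - f)) \<longlonglongrightarrow> 0" by blast
  have norm_f: "(pw_norm f)\<^sup>2 \<le> d"
  proof -
    have "pw_norm f \<le> sqrt (d + 1 / real (Suc n)) + pw_norm (u n - f)" for n
    proof -
      have "pw_norm f \<le> pw_norm (f - u n) + pw_norm (u n)"
        using pw_norm_triangle[OF paley_wiener_diff[OF f u] u \<open>\<sigma> > 0\<close>, of n n] by simp
      moreover have "pw_norm (u n) \<le> sqrt (d + 1 / real (Suc n))"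
        using H(2)[of n] by (intro real_le_rsqrt) (simp add: u_def)
      ultimately show ?thesis by (simp add: pw_norm_minus_commute)
    qed
    moreover have "(\<lambda>n. sqrt (d + 1 / real (Suc n)) + pw_norm (u n - f)) \<longlonglongrightarrow> sqrt (d + 0) + 0"
      by (intro tendsto_intros lim LIMSEQ_Suc[OF lim_const_over_n])
    ultimately have "pw_norm f \<le> sqrt d" using LIMSEQ_le_const by fastforce
    moreover have "d \<ge> 0" unfolding d_def using cfun.span_zero[of S] by (intro cINF_greatest) auto
    ultimately show ?thesis using power_mono[OF _ pw_norm_nonneg, of f "sqrt d" 2] by simp
  qed
  have minimal: "d \<le> (pw_norm (f - v))\<^sup>2" if "v \<in> ?V" for v
  proof -
    have "sqrt d \<le> pw_norm (f - v) + pw_norm (u n - f)" for n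
    proof -
      have "d \<le> (pw_norm (g - (H n + v)))\<^sup>2" using d_le cfun.span_add[OF H(1) that] by blast
      also have "g - (H n + v) = u n - v" by (simp add: u_def fun_eq_iff)
      finally have "d \<le> (pw_norm (u n - v))\<^sup>2" .
      then have "sqrt d \<le> pw_norm (u n - v)" by (rule real_le_lsqrt[OF pw_norm_nonneg])
      also have "u n - v = (f - v) + (u n - f)" by (simp add: fun_eq_iff)
      also have "pw_norm \<dots> \<le> pw_norm (f - v) + pw_norm (u n - f)"
        by (intro pw_norm_triangle[OF _ _ \<open>\<sigma> > 0\<close>] paley_wiener_diff f u V that)
      finally show ?thesis .
    qed
    moreover have "(\<lambda>n. pw_norm (f - v) + pw_norm (u n - f)) \<longlonglongrightarrow> pw_norm (f - v) + 0"
      by (intro tendsto_intros lim)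
    ultimately have "sqrt d \<le> pw_norm (f - v)" using LIMSEQ_le_const by fastforce
    then show ?thesis by (rule sqrt_le_D)
  qed
  have "pw_inner f s = 0" if "s \<in> S" for s
  proof (rule ccontr)
    assume X: "pw_inner f s \<noteq> 0"
    define N where "N = (pw_norm s)\<^sup>2"
    \<comment> \<open>Subtracting \<open>t \<langle>f, s\<rangle> s\<close> shortens \<open>f\<close> as soon as \<open>t \<parallel>s\<parallel>\<^sup>2 < 2\<close>.\<close>
    define t where "t = 1 / (N + 1)"
    have "N \<ge> 0" by (simp add: N_def)
    then have "t > 0" "t * N < 1" by (simp_all add: t_def)
    define c where "c = of_real t * pw_inner f s"
    have s: "s \<in> paley_wiener \<sigma>" using S that by blast
    have "scaleF c s \<in> ?V" using cfun.span_scale[OF cfun.span_base[OF that]] .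
    then have "(pw_norm f)\<^sup>2 \<le> (pw_norm (f - scaleF c s))\<^sup>2" using minimal norm_f by force
    also have "\<dots> = (pw_norm f)\<^sup>2 - 2 * Re (cnj c * pw_inner f s) + (cmod c)\<^sup>2 * N"
      unfolding pw_norm_square_diff[OF f paley_wiener_scaleF[OF s]]
      by (simp add: pw_inner_scaleF_right pw_norm_scaleF power_mult_distrib N_def)
    also have "cnj c * pw_inner f s = of_real (t * (cmod (pw_inner f s))\<^sup>2)"
      using complex_norm_square[of "pw_inner f s"] by (simp add: c_def mult_ac)
    also have "Re \<dots> = t * (cmod (pw_inner f s))\<^sup>2" by simp
    also have "(cmod c)\<^sup>2 = t * t * (cmod (pw_inner f s))\<^sup>2"
      by (simp add: c_def norm_mult power2_eq_square)
    finally have "2 * (t * (cmod (pw_inner f s))\<^sup>2) \<le> (t * N) * (t * (cmod (pw_inner f s))\<^sup>2)"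
      by (simp add: mult_ac)
    moreover have "t * (cmod (pw_inner f s))\<^sup>2 > 0" using X \<open>t > 0\<close> by simp
    ultimately have "2 \<le> t * N" by (simp only: mult_le_cancel_right_pos)
    with \<open>t * N < 1\<close> show False by simp
  qed
  with trivial[OF f] have "f = 0" by blast
  with lim have "(\<lambda>n. pw_norm (u n)) \<longlonglongrightarrow> 0" by simp
  from order_tendstoD(2)[OF this \<open>\<epsilon> > 0\<close>] obtain n where "pw_norm (u n) < \<epsilon>"
    by (auto simp: eventually_sequentially)
  then show ?thesis using H(1)[of n] by (auto simp: u_def)
qed

text \<open>Evaluates the definite description in \<open>pw_adjoint\<close> at a single vector, from a candidate for its
  image; two candidates differ by a vector orthogonal to itself.\<close>

lemma pw_adjoint_eqI:
  assumes "\<sigma> > 0" and h: "h \<in> paley_wiener \<sigma>"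
    and adj: "\<And>f. f \<in> paley_wiener \<sigma> \<Longrightarrow> pw_inner (T f) g = pw_inner f h"
  shows "pw_adjoint \<sigma> T g = h"
  unfolding pw_adjoint_def
proof (rule the_equality)
  fix h' assume h': "h' \<in> paley_wiener \<sigma> \<and> (\<forall>f\<in>paley_wiener \<sigma>. pw_inner (T f) g = pw_inner f h')"
  have d: "h' - h \<in> paley_wiener \<sigma>" using h h' by (simp add: paley_wiener_diff)
  have "pw_inner (h' - h) (h' - h) = pw_inner (h' - h) h' - pw_inner (h' - h) h"
    using pw_inner_diff_right[OF _ h d] h' by simp
  also have "\<dots> = 0" using adj[OF d] h' d by simp
  finally have "pw_norm (h' - h) = 0" by (simp add: pw_inner_self)
  then have "h' - h = 0" by (rule pw_norm_eq_0D[OF d \<open>\<sigma> > 0\<close>])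
  then show "h' = h" by simp
qed (use h adj in auto)

lemma pw_adjoint_comp_op_kernel:
  assumes "\<sigma> > 0" and T: "\<And>f. f \<in> paley_wiener \<sigma> \<Longrightarrow> comp_op \<phi> f \<in> paley_wiener \<sigma>"
  shows "pw_adjoint \<sigma> (comp_op \<phi>) (pw_kernel \<sigma> w) = pw_kernel \<sigma> (\<phi> w)"
proof (rule pw_adjoint_eqI[OF \<open>\<sigma> > 0\<close> pw_kernel_in_paley_wiener[OF \<open>\<sigma> > 0\<close>]])
  fix f assume f: "f \<in> paley_wiener \<sigma>"
  show "pw_inner (comp_op \<phi> f) (pw_kernel \<sigma> w) = pw_inner f (pw_kernel \<sigma> (\<phi> w))"
    using paley_wiener_reproducing[OF T[OF f] \<open>\<sigma> > 0\<close>, of w] paley_wiener_reproducing[OF f \<open>\<sigma> > 0\<close>, of "\<phi> w"]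
    by (simp add: comp_op_def)
qed

text \<open>The orbit starting at \<open>p + 1\<close>, with \<open>p\<close> the fixed point of \<open>\<phi>\<close>, is \<open>p + a\<^sup>n\<close>: it never meets \<open>p\<close> since
  \<open>a \<noteq> 0\<close>, and converges to it since \<open>\<bar>a\<bar> < 1\<close>. The identity theorem then shows that only \<open>0\<close> is orthogonal to
  the kernels along the orbit.\<close>

theorem adjoint_comp_op_affine_cyclic:
  fixes a \<sigma> :: real
  assumes "0 < \<bar>a\<bar>" "\<bar>a\<bar> < 1" "\<sigma> > 0"
  shows "pw_cyclic \<sigma> (pw_adjoint \<sigma> (comp_op (\<lambda>z. of_real a * z + b)))"
proof -
  define \<phi> where "\<phi> = (\<lambda>z. of_real a * z + b)"
  have T: "comp_op \<phi> f \<in> paley_wiener \<sigma>" if "f \<in> paley_wiener \<sigma>" for f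
    unfolding \<phi>_def
    by (rule paley_wiener_mono[OF comp_op_affine_in_paley_wiener[OF that]]) (use assms in auto)
  define p where "p = b / (1 - of_real a)"
  have a1: "complex_of_real a \<noteq> 1" using assms by auto
  have fixpoint: "\<phi> p = p" using a1 by (simp add: \<phi>_def p_def field_simps)
  define v where "v n = p + of_real (a ^ n)" for n
  have "\<phi> (v n) = v (Suc n)" for n
    using fixpoint by (simp add: \<phi>_def v_def algebra_simps)
  then have iter: "(pw_adjoint \<sigma> (comp_op \<phi>) ^^ n) (pw_kernel \<sigma> (v 0)) = pw_kernel \<sigma> (v n)" for n
    by (induction n) (simp_all add: pw_adjoint_comp_op_kernel[OF \<open>\<sigma> > 0\<close> T])
  have lim: "p islimpt range v"
    unfolding islimpt_sequential
  proof (intro exI conjI allI)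
    show "v n \<in> range v - {p}" for n using assms by (simp add: v_def)
    have "(\<lambda>n. a ^ n) \<longlonglongrightarrow> 0" by (rule LIMSEQ_abs_realpow_zero2) (use assms in simp)
    then have "(\<lambda>n. p + of_real (a ^ n)) \<longlonglongrightarrow> p + of_real 0"
      by (intro tendsto_add tendsto_const tendsto_of_real)
    then show "v \<longlonglongrightarrow> p" by (simp add: v_def[abs_def])
  qed
  have trivial: "f = 0" if f: "f \<in> paley_wiener \<sigma>"
    and orth: "\<And>s. s \<in> range (\<lambda>n. pw_kernel \<sigma> (v n)) \<Longrightarrow> pw_inner f s = 0" for f
  proof
    fix z
    have "f z = 0"
    proof (rule analytic_continuation[OF paley_wienerD(1)[OF f] open_UNIV connected_UNIV subset_UNIV UNIV_I lim _ UNIV_I])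
      fix x assume "x \<in> range v"
      then show "f x = 0" using paley_wiener_reproducing[OF f \<open>\<sigma> > 0\<close>] orth by auto
    qed
    then show "f z = 0 z" by simp
  qed
  show ?thesis
    unfolding pw_cyclic_def \<phi>_def[symmetric]
  proof (rule bexI[of _ "pw_kernel \<sigma> (v 0)"], intro ballI allI impI)
    fix g and \<epsilon> :: real assume "g \<in> paley_wiener \<sigma>" "\<epsilon> > 0"
    then show "\<exists>h\<in>cfun.span (range (\<lambda>n. (pw_adjoint \<sigma> (comp_op \<phi>) ^^ n) (pw_kernel \<sigma> (v 0)))). pw_norm (g - h) < \<epsilon>"
      unfolding iter using pw_kernel_in_paley_wiener[OF \<open>\<sigma> > 0\<close>]
      by (intro pw_dense_if_orthogonal_trivial[OF _ \<open>\<sigma> > 0\<close>] trivial) auto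
  qed (rule pw_kernel_in_paley_wiener[OF \<open>\<sigma> > 0\<close>])
qed

section \<open>Complex symmetry\<close>

text \<open>From \<open>J T = T\<^sup>* J\<close> and \<open>J\<^sup>2 = I\<close> follows \<open>J (T\<^sup>*)\<^sup>n v = T\<^sup>n (J v)\<close>. As an antilinear isometry, \<open>J\<close> maps the dense
  span of one orbit onto that of the other.\<close>

theorem pw_complex_symmetric_cyclic_transfer:
  assumes "pw_complex_symmetric \<sigma> T"
    and T: "\<And>f. f \<in> paley_wiener \<sigma> \<Longrightarrow> T f \<in> paley_wiener \<sigma>"
    and "pw_cyclic \<sigma> (pw_adjoint \<sigma> T)"
  shows "pw_cyclic \<sigma> T"
proof -
  let ?A = "pw_adjoint \<sigma> T"
  obtain J where "pw_conjugation \<sigma> J" and JT: "\<And>f. f \<in> paley_wiener \<sigma> \<Longrightarrow> J (T f) = ?A (J f)"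
    using assms(1) unfolding pw_complex_symmetric_def by blast
  then have J_in: "\<And>f. f \<in> paley_wiener \<sigma> \<Longrightarrow> J f \<in> paley_wiener \<sigma>"
    and J_add: "\<And>f g. f \<in> paley_wiener \<sigma> \<Longrightarrow> g \<in> paley_wiener \<sigma> \<Longrightarrow> J (f + g) = J f + J g"
    and J_scale: "\<And>c f. f \<in> paley_wiener \<sigma> \<Longrightarrow> J (scaleF c f) = scaleF (cnj c) (J f)"
    and J_inner: "\<And>f g. f \<in> paley_wiener \<sigma> \<Longrightarrow> g \<in> paley_wiener \<sigma> \<Longrightarrow> pw_inner (J f) (J g) = pw_inner g f"
    and J_J: "\<And>f. f \<in> paley_wiener \<sigma> \<Longrightarrow> J (J f) = f"
    unfolding pw_conjugation_def by blast+
  have J_norm: "pw_norm (J f) = pw_norm f" if "f \<in> paley_wiener \<sigma>" for f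
  proof -
    have "complex_of_real ((pw_norm (J f))\<^sup>2) = of_real ((pw_norm f)\<^sup>2)"
      unfolding pw_inner_self[symmetric] using J_inner[OF that that] .
    then have "(pw_norm (J f))\<^sup>2 = (pw_norm f)\<^sup>2" unfolding of_real_eq_iff .
    then show ?thesis by (rule power2_eq_imp_eq) (rule pw_norm_nonneg)+
  qed
  have J_diff: "J (f - g) = J f - J g" if "f \<in> paley_wiener \<sigma>" "g \<in> paley_wiener \<sigma>" for f g
    unfolding diff_eq_add_scaleF J_add[OF that(1) paley_wiener_scaleF[OF that(2)]] J_scale[OF that(2)] by simp
  have A_eq: "?A g = J (T (J g))" if "g \<in> paley_wiener \<sigma>" for g
    using JT[OF J_in[OF that]] J_J[OF that] by simp
  obtain v where v: "v \<in> paley_wiener \<sigma>"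
    and dense: "\<And>g \<epsilon>. g \<in> paley_wiener \<sigma> \<Longrightarrow> \<epsilon> > 0 \<Longrightarrow> \<exists>h\<in>cfun.span (range (\<lambda>n. (?A ^^ n) v)). pw_norm (g - h) < \<epsilon>"
    using assms(3) unfolding pw_cyclic_def by blast
  have iter_in: "(?A ^^ n) v \<in> paley_wiener \<sigma>" for n
    by (induction n) (simp_all add: v A_eq J_in T)
  have iter: "J ((?A ^^ n) v) = (T ^^ n) (J v)" for n
  proof (induction n)
    case (Suc n)
    have "J ((?A ^^ Suc n) v) = T (J ((?A ^^ n) v))"
      using A_eq[OF iter_in] J_J[OF T[OF J_in[OF iter_in]]] by simp
    then show ?case using Suc by simp
  qed simp
  let ?W = "cfun.span (range (\<lambda>n. (T ^^ n) (J v)))"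
  have "J 0 = 0" using J_scale[OF v, of 0] by simp
  then have "cfun.subspace {h \<in> paley_wiener \<sigma>. J h \<in> ?W}"
    unfolding cfun.subspace_def
    by (auto simp: paley_wiener_zero paley_wiener_add paley_wiener_scaleF J_add J_scale
        cfun.span_zero cfun.span_add cfun.span_scale)
  then have sub: "cfun.span (range (\<lambda>n. (?A ^^ n) v)) \<subseteq> {h \<in> paley_wiener \<sigma>. J h \<in> ?W}"
    by (intro cfun.span_minimal) (auto simp: iter_in iter intro: cfun.span_base)
  show ?thesis
    unfolding pw_cyclic_def
  proof (rule bexI[of _ "J v"], intro ballI allI impI)
    fix g and \<epsilon> :: real assume g: "g \<in> paley_wiener \<sigma>" and "\<epsilon> > 0"
    obtain h where "h \<in> cfun.span (range (\<lambda>n. (?A ^^ n) v))" and lt: "pw_norm (J g - h) < \<epsilon>"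
      using dense[OF J_in[OF g] \<open>\<epsilon> > 0\<close>] by blast
    with sub have h: "h \<in> paley_wiener \<sigma>" "J h \<in> ?W" by auto
    have "pw_norm (g - J h) = pw_norm (J (J g - h))" using J_diff[OF J_in[OF g] h(1)] J_J[OF g] by simp
    also have "\<dots> = pw_norm (J g - h)" by (rule J_norm[OF paley_wiener_diff[OF J_in[OF g] h(1)]])
    finally show "\<exists>h\<in>?W. pw_norm (g - h) < \<epsilon>" using h(2) lt by (intro bexI[of _ "J h"]) auto
  qed (rule J_in[OF v])
qed

theorem proposition3p1:
  fixes a \<sigma> :: real and b :: complex and \<phi> :: "complex \<Rightarrow> complex"
  assumes "0 < \<bar>a\<bar>" and "\<bar>a\<bar> < 1" and "\<sigma> > 0"
    and "\<phi> = (\<lambda>z. of_real a * z + b)"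
  shows "\<not> pw_cyclic \<sigma> (comp_op \<phi>)
    \<and> pw_cyclic \<sigma> (pw_adjoint \<sigma> (comp_op \<phi>))
    \<and> \<not> pw_complex_symmetric \<sigma> (comp_op \<phi>)"
proof -
  have T: "comp_op \<phi> f \<in> paley_wiener \<sigma>" if "f \<in> paley_wiener \<sigma>" for f
    unfolding assms(4)
    by (rule paley_wiener_mono[OF comp_op_affine_in_paley_wiener[OF that]]) (use assms in auto)
  have not_cyclic: "\<not> pw_cyclic \<sigma> (comp_op \<phi>)"
    unfolding assms(4) by (rule comp_op_affine_not_cyclic[OF assms(1-3)])
  have adjoint_cyclic: "pw_cyclic \<sigma> (pw_adjoint \<sigma> (comp_op \<phi>))"
    unfolding assms(4) by (rule adjoint_comp_op_affine_cyclic[OF assms(1-3)])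
  show ?thesis
    using not_cyclic adjoint_cyclic pw_complex_symmetric_cyclic_transfer[of \<sigma> "comp_op \<phi>", OF _ T] by blast
qed

end
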